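(* Let $(\mathfrak{X},\Gamma,\Phi)$ be an odometer. If $\mathcal{G}$ and $\widetilde{\mathcal{G}}$ are any two group chain models for $(\mathfrak{X},\Gamma,\Phi)$, then $\xi(\mathcal{G})=\xi(\widetilde{\mathcal{G}})$ as Steinitz numbers; hence there is a well-defined Steinitz number $\xi(\mathfrak{X},\Gamma,\Phi):=\xi(\mathcal{G})$ associated to the action (its Steinitz order). Moreover, if $(\mathfrak{X}',\Gamma',\Phi')$ is a $\Gamma'$-odometer which is return equivalent to $(\mathfrak{X},\Gamma,\Phi)$, then $\tau[\xi(\mathfrak{X},\Gamma,\Phi)]=\tau[\xi(\mathfrak{X}',\Gamma',\Phi')]$; that is, their types are equal.
   Context: Odometers. A Cantor action $(\mathfrak{X},\Gamma,\Phi)$ is an action $\Phi\colon\Gamma\times\mathfrak{X}\to\mathfrak{X}$ of a group $\Gamma$ by homeomorphisms on a Cantor space $\mathfrak{X}$; write $g\cdot x=\Phi(g)(x)$. It is minimal if every orbit is dense, and equicontinuous if for a (equivalently any) metric $d_{\mathfrak{X}}$ compatible with the topology, for all $\varepsilon>0$ there is $\delta>0$ such that $d_{\mathfrak{X}}(x,y)<\delta$ implies $d_{\mathfrak{X}}(g\cdot x,g\cdot y)<\varepsilon$ for all $g\in\Gamma$. A ($\Gamma$-)odometer is a minimal equicontinuous Cantor action. Group chain models. A group chain $\mathcal{G}=\{\Gamma=\Gamma_0\supset\Gamma_1\supset\Gamma_2\supset\cdots\}$ is a descending chain of finite index subgroups (not assumed normal). Put $X_\ell=\Gamma/\Gamma_\ell$,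 let $X_\infty=\varprojlim\{X_{\ell+1}\to X_\ell\}$ be the inverse limit of the natural quotient maps, and let $\Phi_\infty$ be the action of $\Gamma$ on $X_\infty$ induced by left multiplication. $\mathcal{G}$ is a group chain model for $(\mathfrak{X},\Gamma,\Phi)$ if there is a homeomorphism $\mathfrak{X}\to X_\infty$ conjugating $\Phi$ to $\Phi_\infty$ (as $\Gamma$-actions). It is a known fact that every odometer has a group chain model. Steinitz numbers. A Steinitz number is a formal product $\xi=\prod_{p}p^{\chi_\xi(p)}$ over all primes $p$, with $\chi_\xi(p)\in\{0,1,\ldots,\infty\}$; the least common multiple of a collection of positive integers is a Steinitz number, with exponent at $p$ the supremum of the exponents. $\xi,\xi'$ are asymptotically equivalent if there are integers $m,m'\ge1$ with $m\cdot\xi=m'\cdot\xi'$; the equivalence class of $\xi$ is its type $\tau[\xi]$. For a group chain, $\xi(\mathcal{G})=\mathrm{lcm}\{[\Gamma:\Gamma_\ell]\mid\ell>0\}$. Return equivalence. A non-empty clopen set $U\subset\mathfrak{X}$ is adapted if for all $g\in\Gamma$, $g\cdot U\cap U\neq\emptyset$ implies $g\cdot U=U$; then $\Gamma_U=\{g\in\Gamma\mid g\cdot U\cap U\ne\emptyset\}$ is a finite index subgroup which acts on $U$; let $\mathcal{H}_U\subset\mathrm{Homeo}(U)$ be the image of $\Gamma_U$, acting on $U$ by $\Phi_U$. Actions $(\mathfrak{X}_1,\Gamma_1,\Phi_1)$, $(\mathfrak{X}_2,\Gamma_2,\Phi_2)$ are isomorphic if there are a homeomorphism $h\colon\mathfrak{X}_1\to\mathfrak{X}_2$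 and a group isomorphism $\Theta\colon\Gamma_1\to\Gamma_2$ with $\Phi_1(g)=h^{-1}\circ\Phi_2(\Theta(g))\circ h$ for all $g\in\Gamma_1$. Odometers $(\mathfrak{X},\Gamma,\Phi)$ and $(\mathfrak{X}',\Gamma',\Phi')$ are return equivalent if there are adapted sets $U\subset\mathfrak{X}$, $U'\subset\mathfrak{X}'$ such that $(U,\mathcal{H}_U,\Phi_U)$ and $(U',\mathcal{H}'_{U'},\Phi'_{U'})$ are isomorphic. *)

theory Defs
  imports
    "HOL-Analysis.Analysis"
    "HOL-Algebra.Left_Coset"
    "HOL-Algebra.Group_Action"
    "HOL-Library.Extended_Nat"
    "HOL-Computational_Algebra.Primes"
begin

section \<open>Odometers\<close>

definition cantor_space :: "'a topology \<Rightarrow> bool" where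
  "cantor_space X \<longleftrightarrow>
     X homeomorphic_space
       product_topology (\<lambda>_::nat. discrete_topology (UNIV :: bool set)) UNIV"

text \<open>
  The library's \<^locale>\<open>group_action\<close> maps into \<^const>\<open>BijGroup\<close>, whose elements are
  extensional functions. So each \<open>\<phi> g\<close> is \<^const>\<open>undefined\<close> outside the space; this makes
  two homeomorphisms of the space equal precisely when they agree on it.
\<close>

definition cantor_action ::
  "'a topology \<Rightarrow> ('g, 'm) monoid_scheme \<Rightarrow> ('g \<Rightarrow> 'a \<Rightarrow> 'a) \<Rightarrow> bool" where
  "cantor_action X G \<phi> \<longleftrightarrow>
     cantor_space X \<and> group_action G (topspace X) \<phi> \<and>
     (\<forall>g\<in>carrier G. homeomorphic_map X X (\<phi> g))"

definition minimal_action ::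
  "'a topology \<Rightarrow> ('g, 'm) monoid_scheme \<Rightarrow> ('g \<Rightarrow> 'a \<Rightarrow> 'a) \<Rightarrow> bool" where
  "minimal_action X G \<phi> \<longleftrightarrow>
     (\<forall>x\<in>topspace X. X closure_of (orbit G \<phi> x) = topspace X)"

definition equicontinuous_action ::
  "'a topology \<Rightarrow> ('g, 'm) monoid_scheme \<Rightarrow> ('g \<Rightarrow> 'a \<Rightarrow> 'a) \<Rightarrow> bool" where
  "equicontinuous_action X G \<phi> \<longleftrightarrow>
     (\<exists>d. Metric_space (topspace X) d \<and> Metric_space.mtopology (topspace X) d = X \<and>
        (\<forall>\<epsilon>>0. \<exists>\<delta>>0. \<forall>x\<in>topspace X. \<forall>y\<in>topspace X. d x y < \<delta> \<longrightarrow>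
           (\<forall>g\<in>carrier G. d (\<phi> g x) (\<phi> g y) < \<epsilon>)))"

definition odometer ::
  "'a topology \<Rightarrow> ('g, 'm) monoid_scheme \<Rightarrow> ('g \<Rightarrow> 'a \<Rightarrow> 'a) \<Rightarrow> bool" where
  "odometer X G \<phi> \<longleftrightarrow>
     cantor_action X G \<phi> \<and> minimal_action X G \<phi> \<and> equicontinuous_action X G \<phi>"


section \<open>Group chain models\<close>

text \<open>The inclusions in a chain are not required to be strict.\<close>

definition group_chain :: "('g, 'm) monoid_scheme \<Rightarrow> (nat \<Rightarrow> 'g set) \<Rightarrow> bool" where
  "group_chain G \<G> \<longleftrightarrow>
     \<G> 0 = carrier G \<and>
     (\<forall>l. subgroup (\<G> l) G \<and> finite (lcosets\<^bsub>G\<^esub> (\<G> l)) \<and> \<G> (Suc l) \<subseteq> \<G> l)"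

text \<open>
  The quotient map sends \<open>a \<Gamma>\<^sub>l\<^sub>+\<^sub>1\<close> to \<open>a \<Gamma>\<^sub>l\<close>, which is the set product of
  \<open>a \<Gamma>\<^sub>l\<^sub>+\<^sub>1\<close> and \<open>\<Gamma>\<^sub>l\<close>.
\<close>

definition chain_quotient_map ::
  "('g, 'm) monoid_scheme \<Rightarrow> (nat \<Rightarrow> 'g set) \<Rightarrow> nat \<Rightarrow> 'g set \<Rightarrow> 'g set" where
  "chain_quotient_map G \<G> l C = C <#>\<^bsub>G\<^esub> \<G> l"

definition chain_limit ::
  "('g, 'm) monoid_scheme \<Rightarrow> (nat \<Rightarrow> 'g set) \<Rightarrow> (nat \<Rightarrow> 'g set) topology" where
  "chain_limit G \<G> =
     subtopology
       (product_topology (\<lambda>l. discrete_topology (lcosets\<^bsub>G\<^esub> (\<G> l))) UNIV)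
       {x. \<forall>l. x l = chain_quotient_map G \<G> l (x (Suc l))}"

definition chain_action ::
  "('g, 'm) monoid_scheme \<Rightarrow> 'g \<Rightarrow> (nat \<Rightarrow> 'g set) \<Rightarrow> (nat \<Rightarrow> 'g set)" where
  "chain_action G g x = (\<lambda>l. g <#\<^bsub>G\<^esub> x l)"

definition group_chain_model ::
  "'a topology \<Rightarrow> ('g, 'm) monoid_scheme \<Rightarrow> ('g \<Rightarrow> 'a \<Rightarrow> 'a) \<Rightarrow> (nat \<Rightarrow> 'g set) \<Rightarrow> bool" where
  "group_chain_model X G \<phi> \<G> \<longleftrightarrow>
     group_chain G \<G> \<and>
     (\<exists>h. homeomorphic_map X (chain_limit G \<G>) h \<and>
        (\<forall>g\<in>carrier G. \<forall>x\<in>topspace X. h (\<phi> g x) = chain_action G g (h x)))"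


section \<open>Steinitz numbers\<close>

text \<open>
  A Steinitz number is its family of exponents. Forcing the value \<open>0\<close> off the primes makes
  equality of Steinitz numbers the equality of all exponents at primes.
\<close>

typedef steinitz = "{e :: nat \<Rightarrow> enat. \<forall>p. \<not> prime p \<longrightarrow> e p = 0}"
  morphisms steinitz_exponent Abs_steinitz
  by (rule exI[of _ "\<lambda>_. 0"]) simp

setup_lifting type_definition_steinitz

lift_definition steinitz_lcm :: "nat set \<Rightarrow> steinitz" is
  "\<lambda>A p. if prime p then (SUP n\<in>A. enat (multiplicity p n)) else 0"
  by simp

lift_definition steinitz_scale :: "nat \<Rightarrow> steinitz \<Rightarrow> steinitz" is
  "\<lambda>m e p. if prime p then enat (multiplicity p m) + e p else 0"
  by simp

definition steinitz_asymp_equiv :: "steinitz \<Rightarrow> steinitz \<Rightarrow> bool" where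
  "steinitz_asymp_equiv \<xi> \<xi>' \<longleftrightarrow>
     (\<exists>m\<ge>1. \<exists>m'\<ge>1. steinitz_scale m \<xi> = steinitz_scale m' \<xi>')"

definition steinitz_type :: "steinitz \<Rightarrow> steinitz set" where
  "steinitz_type \<xi> = {\<xi>'. steinitz_asymp_equiv \<xi> \<xi>'}"

definition chain_steinitz :: "('g, 'm) monoid_scheme \<Rightarrow> (nat \<Rightarrow> 'g set) \<Rightarrow> steinitz" where
  "chain_steinitz G \<G> = steinitz_lcm {card (lcosets\<^bsub>G\<^esub> (\<G> l)) | l. l > 0}"

definition steinitz_order ::
  "'a topology \<Rightarrow> ('g, 'm) monoid_scheme \<Rightarrow> ('g \<Rightarrow> 'a \<Rightarrow> 'a) \<Rightarrow> steinitz" where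
  "steinitz_order X G \<phi> =
     (THE \<xi>. \<exists>\<G>. group_chain_model X G \<phi> \<G> \<and> \<xi> = chain_steinitz G \<G>)"


section \<open>Return equivalence\<close>

definition adapted_set ::
  "'a topology \<Rightarrow> ('g, 'm) monoid_scheme \<Rightarrow> ('g \<Rightarrow> 'a \<Rightarrow> 'a) \<Rightarrow> 'a set \<Rightarrow> bool" where
  "adapted_set X G \<phi> U \<longleftrightarrow>
     U \<noteq> {} \<and> openin X U \<and> closedin X U \<and>
     (\<forall>g\<in>carrier G. \<phi> g ` U \<inter> U \<noteq> {} \<longrightarrow> \<phi> g ` U = U)"

definition return_set ::
  "('g, 'm) monoid_scheme \<Rightarrow> ('g \<Rightarrow> 'a \<Rightarrow> 'a) \<Rightarrow> 'a set \<Rightarrow> 'g set" where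
  "return_set G \<phi> U = {g \<in> carrier G. \<phi> g ` U \<inter> U \<noteq> {}}"

text \<open>
  The image of the return set in the homeomorphisms of \<open>U\<close>. It consists of maps, so it acts
  on \<open>U\<close> by \<open>\<lambda>f. f\<close>.
\<close>

definition holonomy_group ::
  "('g, 'm) monoid_scheme \<Rightarrow> ('g \<Rightarrow> 'a \<Rightarrow> 'a) \<Rightarrow> 'a set \<Rightarrow> ('a \<Rightarrow> 'a) monoid" where
  "holonomy_group G \<phi> U =
     (BijGroup U) \<lparr>carrier := (\<lambda>g. restrict (\<phi> g) U) ` return_set G \<phi> U\<rparr>"

definition isomorphic_actions ::
  "'a topology \<Rightarrow> ('g, 'm) monoid_scheme \<Rightarrow> ('g \<Rightarrow> 'a \<Rightarrow> 'a) \<Rightarrow>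
   'b topology \<Rightarrow> ('h, 'n) monoid_scheme \<Rightarrow> ('h \<Rightarrow> 'b \<Rightarrow> 'b) \<Rightarrow> bool" where
  "isomorphic_actions X1 G1 \<phi>1 X2 G2 \<phi>2 \<longleftrightarrow>
     (\<exists>h k \<Theta>. homeomorphic_maps X1 X2 h k \<and> \<Theta> \<in> iso G1 G2 \<and>
        (\<forall>g\<in>carrier G1. \<forall>x\<in>topspace X1. \<phi>1 g x = k (\<phi>2 (\<Theta> g) (h x))))"

definition return_equivalent ::
  "'a topology \<Rightarrow> ('g, 'm) monoid_scheme \<Rightarrow> ('g \<Rightarrow> 'a \<Rightarrow> 'a) \<Rightarrow>
   'b topology \<Rightarrow> ('h, 'n) monoid_scheme \<Rightarrow> ('h \<Rightarrow> 'b \<Rightarrow> 'b) \<Rightarrow> bool" where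
  "return_equivalent X G \<phi> X' G' \<phi>' \<longleftrightarrow>
     (\<exists>U U'. adapted_set X G \<phi> U \<and> adapted_set X' G' \<phi>' U' \<and>
        isomorphic_actions
          (subtopology X U) (holonomy_group G \<phi> U) (\<lambda>f. f)
          (subtopology X' U') (holonomy_group G' \<phi>' U') (\<lambda>f. f))"

end

theory Submission
  imports Defs
begin

text \<open>
  The Steinitz order of a chain model can be read off the action alone: it is the least common
  multiple of the numbers of translates of adapted sets. The cylinders \<open>x l = \<Gamma>\<^sub>l\<close> of a chain model
  are adapted with \<open>[\<Gamma> : \<Gamma>\<^sub>l]\<close> translates and form a neighbourhood basis, and for adapted
  \<open>V \<subseteq> U\<close> the number of translates of \<open>V\<close> is the number of translates of \<open>U\<close> times the number of
  translates of \<open>V\<close> inside \<open>U\<close>. The last factor depends only on the holonomy action on \<open>U\<close>, so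
  up to the factor given by \<open>U\<close> the order is an invariant of return equivalence.
  Chain models exist because, by equicontinuity, having the same itinerary with respect to a finite
  clopen partition is an invariant equivalence relation with clopen classes.
\<close>

section \<open>Adapted sets of minimal actions\<close>

text \<open>The setting for counting translates of adapted sets: minimality makes the translates
  cover the space, compactness makes them finite in number.\<close>

locale minimal_compact_action = group_action G "topspace X" \<phi>
  for X :: "'a topology" and G :: "('g, 'm) monoid_scheme" (structure) and \<phi> :: "'g \<Rightarrow> 'a \<Rightarrow> 'a" +
  assumes homeo: "g \<in> carrier G \<Longrightarrow> homeomorphic_map X X (\<phi> g)"
    and minimal: "minimal_action X G \<phi>"
    and compact: "compact_space X"
begin

sublocale group G
  using group_hom group_hom.axioms(1) by blast

text \<open>For adapted \<open>U\<close> these sets partition the space, and their number is the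
  index of the stabilizer of \<open>U\<close>.\<close>

definition translates :: "'a set \<Rightarrow> 'a set set" where
  "translates U = (\<lambda>g. \<phi> g ` U) ` carrier G"

text \<open>Phrased through \<open>return_set\<close> rather than through inclusion in
  \<open>U\<close>: for \<open>V\<close> inside \<open>U\<close> this form depends only on the maps
  induced on \<open>U\<close>, so a conjugacy of holonomy actions carries it over.\<close>

definition return_translates :: "'a set \<Rightarrow> 'a set \<Rightarrow> 'a set set" where
  "return_translates U V = (\<lambda>g. \<phi> g ` V) ` return_set G \<phi> U"

section \<open>The action on points and on subsets\<close>

lemma act_closed: "g \<in> carrier G \<Longrightarrow> x \<in> topspace X \<Longrightarrow> \<phi> g x \<in> topspace X"
  using element_image by blast

lemma act_one: "x \<in> topspace X \<Longrightarrow> \<phi> \<one> x = x"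
  using id_eq_one by (metis restrict_apply')

lemma act_inv_act: "g \<in> carrier G \<Longrightarrow> x \<in> topspace X \<Longrightarrow> \<phi> (inv g) (\<phi> g x) = x"
  using orbit_sym_aux by blast

lemma act_act_inv: "g \<in> carrier G \<Longrightarrow> x \<in> topspace X \<Longrightarrow> \<phi> g (\<phi> (inv g) x) = x"
  using act_inv_act[of "inv g" x] by simp

lemma image_subset: "g \<in> carrier G \<Longrightarrow> V \<subseteq> topspace X \<Longrightarrow> \<phi> g ` V \<subseteq> topspace X"
  using act_closed by blast

lemma image_mult:
  assumes "g \<in> carrier G" "h \<in> carrier G" "V \<subseteq> topspace X"
  shows "\<phi> (g \<otimes> h) ` V = \<phi> g ` (\<phi> h ` V)"
  using assms composition_rule by (force simp: image_def)

lemma image_one: "V \<subseteq> topspace X \<Longrightarrow> \<phi> \<one> ` V = V"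
  using act_one by (force simp: image_def)

lemma image_inv_image: "g \<in> carrier G \<Longrightarrow> V \<subseteq> topspace X \<Longrightarrow> \<phi> (inv g) ` (\<phi> g ` V) = V"
  using image_mult[of "inv g" g V] image_one by simp

lemma image_image_inv: "g \<in> carrier G \<Longrightarrow> V \<subseteq> topspace X \<Longrightarrow> \<phi> g ` (\<phi> (inv g) ` V) = V"
  using image_mult[of g "inv g" V] image_one by simp

section \<open>Translates of adapted sets and their number\<close>

lemma adapted_subset: "adapted_set X G \<phi> U \<Longrightarrow> U \<subseteq> topspace X"
  unfolding adapted_set_def by (simp add: openin_subset)

text \<open>Moving back by \<open>inv h\<close> reduces the claim to \<open>U\<close> meeting its
  translate by \<open>inv h \<otimes> g\<close>, where adaptedness applies. Hence translates of an
  adapted set are equal or disjoint.\<close>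

lemma adapted_translates_meet:
  assumes U: "adapted_set X G \<phi> U" and g: "g \<in> carrier G" and h: "h \<in> carrier G"
    and meet: "\<phi> g ` U \<inter> \<phi> h ` U \<noteq> {}"
  shows "\<phi> g ` U = \<phi> h ` U"
proof -
  note sub = adapted_subset[OF U]
  obtain x y where xy: "x \<in> U" "y \<in> U" "\<phi> g x = \<phi> h y"
    using meet by auto
  have "\<phi> (inv h \<otimes> g) x = y"
    using xy sub g h by (simp add: composition_rule subsetD act_inv_act)
  then have "\<phi> (inv h \<otimes> g) ` U \<inter> U \<noteq> {}"
    using xy by blast
  then have eq: "\<phi> (inv h \<otimes> g) ` U = U"
    using U g h unfolding adapted_set_def by simp
  have "\<phi> g ` U = \<phi> (h \<otimes> (inv h \<otimes> g)) ` U"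
    using g h by (simp add: m_assoc[symmetric])
  also have "\<dots> = \<phi> h ` U"
    using g h sub eq by (subst image_mult) auto
  finally show ?thesis .
qed

lemma adapted_translate:
  assumes U: "adapted_set X G \<phi> U" and g: "g \<in> carrier G"
  shows "adapted_set X G \<phi> (\<phi> g ` U)"
proof -
  note sub = adapted_subset[OF U]
  have "\<phi> h ` \<phi> g ` U = \<phi> g ` U" if "h \<in> carrier G" "\<phi> h ` \<phi> g ` U \<inter> \<phi> g ` U \<noteq> {}" for h
    using adapted_translates_meet[OF U, of "h \<otimes> g" g] that g sub by (simp add: image_mult)
  moreover have "openin X (\<phi> g ` U)" "closedin X (\<phi> g ` U)"
    using U homeo[OF g] sub unfolding adapted_set_def
    by (auto simp: homeomorphic_map_openness homeomorphic_map_closedness)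
  ultimately show ?thesis
    using U unfolding adapted_set_def by auto
qed

lemma translates_translate:
  assumes g: "g \<in> carrier G" and U: "U \<subseteq> topspace X"
  shows "translates (\<phi> g ` U) = translates U"
proof
  show "translates (\<phi> g ` U) \<subseteq> translates U"
    unfolding translates_def using g by (auto simp: image_mult[OF _ g U, symmetric])
  show "translates U \<subseteq> translates (\<phi> g ` U)"
  proof
    fix W assume "W \<in> translates U"
    then obtain h where h: "h \<in> carrier G" "W = \<phi> h ` U"
      unfolding translates_def by blast
    then have "W = \<phi> (h \<otimes> inv g) ` \<phi> g ` U"
      using g U by (simp add: image_mult image_subset image_inv_image)
    then show "W \<in> translates (\<phi> g ` U)"
      unfolding translates_def using g h by blast
  qed
qed

text \<open>By minimality the orbit of \<open>x\<close> enters the open set \<open>U\<close>; the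
  inverse of the element that brings \<open>x\<close> into \<open>U\<close> is the one
  wanted.\<close>

lemma adapted_cover:
  assumes U: "adapted_set X G \<phi> U" and x: "x \<in> topspace X"
  shows "\<exists>g\<in>carrier G. x \<in> \<phi> g ` U"
proof -
  obtain u where u: "u \<in> U" and "openin X U" "u \<in> topspace X"
    using U adapted_subset[OF U] unfolding adapted_set_def by blast
  then have "\<exists>y\<in>orbit G \<phi> x. y \<in> U"
    using minimal x unfolding minimal_action_def by (metis in_closure_of)
  then obtain g where g: "g \<in> carrier G" "\<phi> g x \<in> U"
    unfolding orbit_def by blast
  then have "x \<in> \<phi> (inv g) ` U"
    using act_inv_act x by (metis imageI)
  then show ?thesis
    using g by blast
qed

text \<open>Distinct translates are disjoint and nonempty, so a finite subcover of the open cover by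
  translates already contains all of them.\<close>

lemma finite_translates:
  assumes U: "adapted_set X G \<phi> U"
  shows "finite (translates U)"
proof -
  have "openin X T" if "T \<in> translates U" for T
    using adapted_translate[OF U] that unfolding translates_def adapted_set_def by auto
  moreover have "topspace X \<subseteq> \<Union>(translates U)"
    using adapted_cover[OF U] unfolding translates_def by blast
  ultimately obtain F where F: "finite F" "F \<subseteq> translates U" "topspace X \<subseteq> \<Union>F"
    using compact unfolding compact_space_alt by metis
  have "T \<in> F" if T: "T \<in> translates U" for T
  proof -
    obtain g where g: "g \<in> carrier G" "T = \<phi> g ` U"
      using T unfolding translates_def by blast
    obtain x where x: "x \<in> T" "x \<in> topspace X"
      using g U adapted_subset[OF U] act_closed unfolding adapted_set_def by blast
    then obtain S where S: "S \<in> F" "x \<in> S"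
      using F by blast
    then obtain h where h: "h \<in> carrier G" "S = \<phi> h ` U"
      using F unfolding translates_def by blast
    show ?thesis
      using adapted_translates_meet[OF U g(1) h(1)] x S by (metis IntI empty_iff g(2) h(2))
  qed
  then show ?thesis
    using F(1) by (meson finite_subset subsetI)
qed

lemma card_translates_nonzero: "adapted_set X G \<phi> U \<Longrightarrow> card (translates U) \<noteq> 0"
  using finite_translates by (auto simp: translates_def)

text \<open>An element that makes \<open>U \<inter> V\<close> meet itself fixes both
  \<open>U\<close> and \<open>V\<close>; injectivity of \<open>\<phi> g\<close> lets images commute
  with the intersection.\<close>

lemma adapted_Int:
  assumes U: "adapted_set X G \<phi> U" and V: "adapted_set X G \<phi> V" and ne: "U \<inter> V \<noteq> {}"
  shows "adapted_set X G \<phi> (U \<inter> V)"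
proof -
  have "\<phi> g ` (U \<inter> V) = U \<inter> V"
    if g: "g \<in> carrier G" and meet: "\<phi> g ` (U \<inter> V) \<inter> (U \<inter> V) \<noteq> {}" for g
  proof -
    have "\<phi> g ` (U \<inter> V) = \<phi> g ` U \<inter> \<phi> g ` V"
      using inj_prop[OF g] adapted_subset[OF U] adapted_subset[OF V] by (rule inj_on_image_Int)
    moreover have "\<phi> g ` U = U" "\<phi> g ` V = V"
      using U V g meet unfolding adapted_set_def by blast+
    ultimately show ?thesis
      by simp
  qed
  then show ?thesis
    using U V ne unfolding adapted_set_def by auto
qed

text \<open>An element returns to \<open>U\<close> exactly when it carries \<open>V\<close> into
  \<open>U\<close>: one direction is adaptedness of \<open>U\<close>, the other uses a point of
  \<open>V\<close>.\<close>

lemma return_translates_eq: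
  assumes U: "adapted_set X G \<phi> U" and V: "adapted_set X G \<phi> V" and VU: "V \<subseteq> U"
  shows "return_translates U V = {W \<in> translates V. W \<subseteq> U}"
proof -
  have "g \<in> return_set G \<phi> U" if "g \<in> carrier G" "\<phi> g ` V \<subseteq> U" for g
  proof -
    obtain v where "v \<in> V"
      using V unfolding adapted_set_def by blast
    then have "\<phi> g v \<in> \<phi> g ` U \<inter> U"
      using that VU by blast
    then show ?thesis
      using that unfolding return_set_def by blast
  qed
  moreover have "\<phi> g ` V \<subseteq> U" if "g \<in> return_set G \<phi> U" for g
  proof -
    have "\<phi> g ` U = U"
      using that U unfolding return_set_def adapted_set_def by simp
    then show ?thesis
      using VU by blast
  qed
  ultimately have "return_set G \<phi> U = {g \<in> carrier G. \<phi> g ` V \<subseteq> U}"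
    unfolding return_set_def by blast
  then show ?thesis
    unfolding return_translates_def translates_def by auto
qed

text \<open>The index formula for nested subgroups, by counting: every translate of \<open>V\<close>
  lies in exactly one translate of \<open>U\<close>, and \<open>\<phi> g\<close> matches those
  inside \<open>U\<close> with those inside the translate of \<open>U\<close> by
  \<open>g\<close>.\<close>

lemma card_translates_mult:
  assumes U: "adapted_set X G \<phi> U" and V: "adapted_set X G \<phi> V" and VU: "V \<subseteq> U"
  shows "card (translates V) = card (translates U) * card (return_translates U V)"
proof -
  define inside where "inside T = {W \<in> translates V. W \<subseteq> T}" for T
  note subU = adapted_subset[OF U] and subV = adapted_subset[OF V]
  have translate_inside: "\<phi> h ` W \<in> inside (\<phi> h ` T)" if "W \<in> inside T" "h \<in> carrier G" for h W T
    using that subV unfolding inside_def translates_def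
    by (auto simp: image_mult[symmetric])
  have card_inside: "card (inside T) = card (return_translates U V)" if T: "T \<in> translates U" for T
  proof -
    obtain g where g: "g \<in> carrier G" "T = \<phi> g ` U"
      using T unfolding translates_def by blast
    have sub: "W \<subseteq> topspace X" if "W \<in> translates V" for W
      using that image_subset subV unfolding translates_def by blast
    have "bij_betw ((`) (\<phi> g)) (inside U) (inside T)"
    proof (rule bij_betw_byWitness[where f' = "(`) (\<phi> (inv g))"])
      show "\<forall>W\<in>inside U. \<phi> (inv g) ` \<phi> g ` W = W" "\<forall>W\<in>inside T. \<phi> g ` \<phi> (inv g) ` W = W"
        using sub g unfolding inside_def by (auto simp: image_inv_image image_image_inv)
      show "(`) (\<phi> g) ` inside U \<subseteq> inside T"
        using translate_inside g by blast
      show "(`) (\<phi> (inv g)) ` inside T \<subseteq> inside U"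
        using translate_inside[of _ T "inv g"] g subU by (auto simp: image_inv_image)
    qed
    then show ?thesis
      using return_translates_eq[OF U V VU] bij_betw_same_card unfolding inside_def by fastforce
  qed
  have "translates V = (\<Union>T\<in>translates U. inside T)"
    unfolding inside_def translates_def using VU by blast
  also have "card \<dots> = (\<Sum>T\<in>translates U. card (inside T))"
  proof (rule card_UN_disjoint)
    show "finite (translates U)" "\<forall>T\<in>translates U. finite (inside T)"
      using finite_translates U V unfolding inside_def by auto
    show "\<forall>S\<in>translates U. \<forall>T\<in>translates U. S \<noteq> T \<longrightarrow> inside S \<inter> inside T = {}"
    proof (intro ballI impI)
      fix S T assume ST: "S \<in> translates U" "T \<in> translates U" "S \<noteq> T"
      then have "S \<inter> T = {}"
        using adapted_translates_meet[OF U] unfolding translates_def by blast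
      \<comment> \<open>A set contained in two disjoint translates of \<open>U\<close> would be
        empty.\<close>
      moreover have "{} \<notin> translates V"
        using V unfolding adapted_set_def translates_def by auto
      ultimately show "inside S \<inter> inside T = {}"
        unfolding inside_def by (auto simp: disjoint_iff) (metis all_not_in_conv subsetD)
    qed
  qed
  also have "\<dots> = card (translates U) * card (return_translates U V)"
    using card_inside by simp
  finally show ?thesis .
qed

text \<open>Minimality moves \<open>W\<close> so that it meets \<open>U\<close>, and
  \<open>V\<close> is the intersection of \<open>U\<close> with this translate. Thus adapted subsets
  of \<open>U\<close> are cofinal for divisibility of the counts.\<close>

lemma refine_adapted:
  assumes U: "adapted_set X G \<phi> U" and W: "adapted_set X G \<phi> W"
  obtains V where "adapted_set X G \<phi> V" "V \<subseteq> U" "card (translates W) dvd card (translates V)"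
proof -
  obtain x where x: "x \<in> U"
    using U unfolding adapted_set_def by blast
  then obtain g where g: "g \<in> carrier G" "x \<in> \<phi> g ` W"
    using adapted_cover[OF W] adapted_subset[OF U] by blast
  note gW = adapted_translate[OF W g(1)]
  have V: "adapted_set X G \<phi> (U \<inter> \<phi> g ` W)"
    using adapted_Int[OF U gW] x g(2) by (metis IntI empty_iff)
  have "card (translates W) dvd card (translates (U \<inter> \<phi> g ` W))"
    using card_translates_mult[OF gW V] translates_translate g adapted_subset[OF W] by simp
  then show ?thesis
    using that[OF V] by blast
qed

text \<open>Otherwise the sets \<open>U l - W\<close> are nonempty, closed and nested, so by
  compactness they share a point; it could only be \<open>x\<close>, which lies in
  \<open>W\<close>.\<close>

lemma nested_closed_subset_open:
  assumes dec: "decseq U" and closed: "\<And>l. closedin X (U l)" and inter: "(\<Inter>l. U l) = {x}"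
    and W: "openin X W" "x \<in> W"
  shows "\<exists>l. U l \<subseteq> W"
proof (rule ccontr)
  assume "\<not> ?thesis"
  moreover have "decseq (\<lambda>l. U l - W)"
    using dec unfolding decseq_def by blast
  moreover have "closedin X (U l - W)" for l
    using closed W by blast
  ultimately have "(\<Inter>l. U l - W) \<noteq> {}"
    using compact_space_imp_nest[OF compact, of "\<lambda>l. U l - W"] by blast
  then show False
    using inter W by auto
qed

end

section \<open>Steinitz numbers\<close>

text \<open>Induction on \<open>k\<close> reduces this to \<open>eSuc\<close> commuting with
  suprema. Nonemptiness matters because the supremum of the empty set is \<open>0\<close>.\<close>

lemma enat_add_SUP:
  assumes "A \<noteq> {}"
  shows "enat k + (SUP a\<in>A. f a) = (SUP a\<in>A. enat k + f a)"
proof (induction k)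
  case (Suc k)
  then have "enat (Suc k) + (SUP a\<in>A. f a) = eSuc (SUP a\<in>A. enat k + f a)"
    by (metis eSuc_enat iadd_Suc)
  also have "\<dots> = (SUP a\<in>A. eSuc (enat k + f a))"
    using assms by (simp add: eSuc_Sup image_image)
  finally show ?case
    by (simp add: eSuc_enat[symmetric] iadd_Suc)
qed (simp add: zero_enat_def[symmetric])

text \<open>Exponents at a prime add under products of nonzero numbers, and the constant summand
  leaves the supremum. Zero is excluded because \<open>multiplicity p 0\<close> is
  \<open>0\<close>.\<close>

lemma steinitz_scale_lcm:
  assumes "c \<noteq> 0" "0 \<notin> A" "A \<noteq> {}"
  shows "steinitz_scale c (steinitz_lcm A) = steinitz_lcm ((*) c ` A)"
  using assms
proof (transfer, intro ext)
  fix c :: nat and A :: "nat set" and p :: nat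
  assume c: "c \<noteq> 0" and A: "0 \<notin> A" "A \<noteq> {}"
  have "multiplicity p (c * n) = multiplicity p c + multiplicity p n" if "prime p" "n \<in> A" for n
    using that A c by (metis prime_elem_multiplicity_mult_distrib prime_imp_prime_elem)
  then show "(if prime p then enat (multiplicity p c) +
          (if prime p then SUP n\<in>A. enat (multiplicity p n) else 0) else 0) =
        (if prime p then SUP n\<in>(*) c ` A. enat (multiplicity p n) else 0)"
    using enat_add_SUP[OF A(2), of "multiplicity p c" "\<lambda>n. enat (multiplicity p n)"]
    by (simp add: image_image cong: image_cong_simp)
qed

text \<open>Divisibility of nonzero numbers bounds exponents, so mutual cofinality forces equal
  suprema at every prime. A \<open>0\<close> would break this: everything divides it, yet its
  multiplicities are \<open>0\<close>.\<close>

lemma steinitz_lcm_eqI: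
  assumes "\<And>a. a \<in> A \<Longrightarrow> \<exists>b\<in>B. a dvd b" "\<And>b. b \<in> B \<Longrightarrow> \<exists>a\<in>A. b dvd a" "0 \<notin> A" "0 \<notin> B"
  shows "steinitz_lcm A = steinitz_lcm B"
proof -
  have le: "(SUP n\<in>A. enat (multiplicity p n)) \<le> (SUP n\<in>B. enat (multiplicity p n))"
    if dvd: "\<And>a. a \<in> A \<Longrightarrow> \<exists>b\<in>B. a dvd b" and B: "0 \<notin> B" for A B :: "nat set" and p
  proof (rule SUP_mono)
    fix a assume "a \<in> A"
    then obtain b where "b \<in> B" "a dvd b"
      using dvd by blast
    then show "\<exists>b\<in>B. enat (multiplicity p a) \<le> enat (multiplicity p b)"
      using B by (intro bexI[of _ b]) (auto intro!: dvd_imp_multiplicity_le gr0I)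
  qed
  have "(SUP n\<in>A. enat (multiplicity p n)) = (SUP n\<in>B. enat (multiplicity p n))" for p
    using le[of A B p] le[of B A p] assms by (auto intro: antisym)
  then show ?thesis
    by (transfer fixing: A B) (intro ext, simp only:)
qed

lemma steinitz_scale_scale:
  "m \<noteq> 0 \<Longrightarrow> n \<noteq> 0 \<Longrightarrow> steinitz_scale m (steinitz_scale n \<xi>) = steinitz_scale (m * n) \<xi>"
proof (transfer, intro ext)
  fix m n :: nat and e :: "nat \<Rightarrow> enat" and p :: nat
  assume "m \<noteq> 0" "n \<noteq> 0"
  then have "multiplicity p (m * n) = multiplicity p m + multiplicity p n" if "prime p"
    using that by (metis prime_elem_multiplicity_mult_distrib prime_imp_prime_elem)
  then show "(if prime p then enat (multiplicity p m) +
        (if prime p then enat (multiplicity p n) + e p else 0) else 0) =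
      (if prime p then enat (multiplicity p (m * n)) + e p else 0)"
    by (simp add: add.assoc plus_enat_simps(1)[symmetric] del: plus_enat_simps)
qed

lemma steinitz_asymp_equiv_sym: "steinitz_asymp_equiv \<xi> \<xi>' \<Longrightarrow> steinitz_asymp_equiv \<xi>' \<xi>"
  unfolding steinitz_asymp_equiv_def by metis

lemma steinitz_asymp_equiv_trans:
  assumes "steinitz_asymp_equiv \<xi> \<xi>'" "steinitz_asymp_equiv \<xi>' \<xi>''"
  shows "steinitz_asymp_equiv \<xi> \<xi>''"
proof -
  obtain m m' n n' where pos: "m \<ge> 1" "m' \<ge> 1" "n \<ge> 1" "n' \<ge> 1"
    and eq: "steinitz_scale m \<xi> = steinitz_scale m' \<xi>'" "steinitz_scale n \<xi>' = steinitz_scale n' \<xi>''"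
    using assms unfolding steinitz_asymp_equiv_def by blast
  \<comment> \<open>The common value reached from both ends is \<open>\<xi>'\<close> scaled by
    \<open>n * m'\<close>.\<close>
  have "steinitz_scale (n * m) \<xi> = steinitz_scale n (steinitz_scale m' \<xi>')"
    using pos by (subst steinitz_scale_scale[symmetric]) (auto simp: eq(1))
  also have "\<dots> = steinitz_scale m' (steinitz_scale n' \<xi>'')"
    using pos by (simp add: steinitz_scale_scale mult.commute flip: eq(2))
  also have "\<dots> = steinitz_scale (m' * n') \<xi>''"
    using pos by (simp add: steinitz_scale_scale)
  finally show ?thesis
    using pos unfolding steinitz_asymp_equiv_def
    by (metis One_nat_def Suc_le_eq nat_0_less_mult_iff)
qed

lemma steinitz_type_eqI: "steinitz_asymp_equiv \<xi> \<xi>' \<Longrightarrow> steinitz_type \<xi> = steinitz_type \<xi>'"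
  unfolding steinitz_type_def
  using steinitz_asymp_equiv_sym steinitz_asymp_equiv_trans by blast

section \<open>Group chain models\<close>

text \<open>Used for consecutive members of a chain: the quotient maps send trivial cosets to
  trivial cosets.\<close>

lemma (in group) subgroup_mult_absorb:
  assumes "subgroup H G" "subgroup K G" "H \<subseteq> K"
  shows "H <#> K = K"
proof
  show "H <#> K \<subseteq> K"
    using assms by (auto simp: set_mult_def intro: subgroup.m_closed)
  show "K \<subseteq> H <#> K"
    using subgroup.one_closed[OF assms(1)] subgroup.mem_carrier[OF assms(2)]
    by (force simp: set_mult_def)
qed

lemma topspace_chain_limit:
  "topspace (chain_limit G \<G>) =
     {x. (\<forall>l. x l \<in> lcosets\<^bsub>G\<^esub> (\<G> l)) \<and> (\<forall>l. x l = x (Suc l) <#>\<^bsub>G\<^esub> \<G> l)}"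
  by (auto simp: chain_limit_def chain_quotient_map_def)

lemma continuous_map_chain_limit_component:
  assumes "continuous_map X (chain_limit G \<G>) h"
  shows "continuous_map X (discrete_topology (lcosets\<^bsub>G\<^esub> (\<G> l))) (\<lambda>x. h x l)"
  using assms
  by (simp add: chain_limit_def continuous_map_in_subtopology continuous_map_componentwise_UNIV)

section \<open>The order from adapted sets, compared with a chain model\<close>

context minimal_compact_action
begin

definition adapted_order :: steinitz where
  "adapted_order = steinitz_lcm {card (translates V) | V. adapted_set X G \<phi> V}"

text \<open>The cylinders over the trivial cosets shrink to one point, so every adapted set has a
  translate containing a cylinder. By the index formula its count divides an index of the chain;
  conversely each index is the count of a cylinder.\<close>

lemma chain_steinitz_eq_adapted_order:
  assumes model: "group_chain_model X G \<phi> \<G>"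
  shows "chain_steinitz G \<G> = adapted_order"
proof -
  have chain: "group_chain G \<G>"
    using model unfolding group_chain_model_def by blast
  have sub: "subgroup (\<G> l) G" and dec: "\<G> (Suc l) \<subseteq> \<G> l" for l
    using chain unfolding group_chain_def by auto
  have subC: "\<G> l \<subseteq> carrier G" for l
    using subgroup.subset[OF sub] .
  obtain h where h: "homeomorphic_map X (chain_limit G \<G>) h"
    and equiv: "\<And>g x l. g \<in> carrier G \<Longrightarrow> x \<in> topspace X \<Longrightarrow> h (\<phi> g x) l = g <# h x l"
    using model unfolding group_chain_model_def chain_action_def by metis
  have inj: "inj_on h (topspace X)" and onto: "h ` topspace X = topspace (chain_limit G \<G>)"
    and cont: "continuous_map X (chain_limit G \<G>) h"
    using h by (auto simp: homeomorphic_eq_everything_map)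
  have in_limit: "h x l \<in> lcosets (\<G> l)" "h x l = h x (Suc l) <#> \<G> l"
    if "x \<in> topspace X" for x l
    using onto that topspace_chain_limit[of G \<G>] by blast+
  have self_coset: "\<G> l \<in> lcosets (\<G> l)" for l
    using coset_join3[OF one_closed sub subgroup.one_closed[OF sub]] unfolding LCOSETS_def by blast
  \<comment> \<open>Read as a sequence of cosets, the chain is itself a point of its limit and
    serves as base point.\<close>
  have "\<G> \<in> topspace (chain_limit G \<G>)"
    using subgroup_mult_absorb[OF sub sub dec] self_coset by (simp add: topspace_chain_limit)
  then obtain x0 where x0: "x0 \<in> topspace X" "h x0 = \<G>"
    using onto by (metis imageE)
  define cyl where "cyl l C = {x \<in> topspace X. h x l = C}" for l C
  define U where "U l = cyl l (\<G> l)" for l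
  have x0U: "x0 \<in> U l" for l
    using x0 unfolding U_def cyl_def by simp
  have subU: "U l \<subseteq> topspace X" for l
    unfolding U_def cyl_def by auto
  have translate_U: "\<phi> g ` U l = cyl l (g <# \<G> l)" if g: "g \<in> carrier G" for g l
  proof
    show "\<phi> g ` U l \<subseteq> cyl l (g <# \<G> l)"
      unfolding U_def cyl_def using act_closed g equiv by auto
    show "cyl l (g <# \<G> l) \<subseteq> \<phi> g ` U l"
    proof
      fix y assume "y \<in> cyl l (g <# \<G> l)"
      then have y: "y \<in> topspace X" "h y l = g <# \<G> l"
        unfolding cyl_def by auto
      then have "h (\<phi> (inv g) y) l = \<G> l"
        using g equiv[of "inv g" y l] subC by (simp add: lcos_m_assoc lcos_mult_one)
      then have "\<phi> (inv g) y \<in> U l"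
        unfolding U_def cyl_def using act_closed g y by simp
      then show "y \<in> \<phi> g ` U l"
        using act_act_inv[OF g y(1)] by (metis imageI)
    qed
  qed
  have clopen: "openin X (U l)" "closedin X (U l)" for l
    using openin_continuous_map_preimage[OF continuous_map_chain_limit_component[OF cont, of l], where U = "{\<G> l}"]
      closedin_continuous_map_preimage[OF continuous_map_chain_limit_component[OF cont, of l], where C = "{\<G> l}"]
      self_coset unfolding U_def cyl_def by auto
  have adapted: "adapted_set X G \<phi> (U l)" for l
  proof -
    \<comment> \<open>The translate is a cylinder of the same level, and cylinders of one level over
      different cosets are disjoint.\<close>
    have "\<phi> g ` U l = U l" if "g \<in> carrier G" "\<phi> g ` U l \<inter> U l \<noteq> {}" for g
      using that unfolding translate_U[OF that(1)] unfolding U_def cyl_def by auto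
    then show ?thesis
      using clopen x0U unfolding adapted_set_def by blast
  qed
  have card_U: "card (translates (U l)) = card (lcosets (\<G> l))" for l
  proof -
    have "translates (U l) = cyl l ` (lcosets (\<G> l))"
      unfolding translates_def LCOSETS_def using translate_U by (auto simp: image_iff)
    \<comment> \<open>A nonempty cylinder determines its coset, so counting cylinders counts
      cosets.\<close>
    moreover have "cyl l C \<noteq> {}" if "C \<in> lcosets (\<G> l)" for C
      using that translate_U x0U unfolding LCOSETS_def by fastforce
    then have "inj_on (cyl l) (lcosets (\<G> l))"
      unfolding cyl_def inj_on_def by blast
    ultimately show ?thesis
      by (simp add: card_image)
  qed
  have "U (Suc l) \<subseteq> U l" for l
    using in_limit(2)[of _ l] subgroup_mult_absorb[OF sub sub dec] unfolding U_def cyl_def by auto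
  then have decU: "decseq U"
    by (rule decseq_SucI)
  have interU: "(\<Inter>l. U l) = {x0}"
  proof -
    have "x = x0" if "x \<in> (\<Inter>l. U l)" for x
    proof -
      have "x \<in> topspace X" "h x = h x0"
        using that x0 unfolding U_def cyl_def by auto
      then show ?thesis
        using inj x0 by (meson inj_onD)
    qed
    then show ?thesis
      using x0U by blast
  qed
  show ?thesis
    unfolding chain_steinitz_def adapted_order_def
  proof (rule steinitz_lcm_eqI)
    fix a assume "a \<in> {card (lcosets (\<G> l)) |l. 0 < l}"
    then obtain l where "a = card (translates (U l))"
      using card_U by auto
    then show "\<exists>b\<in>{card (translates V) |V. adapted_set X G \<phi> V}. a dvd b"
      using adapted dvd_refl by blast
  next
    fix b assume "b \<in> {card (translates V) |V. adapted_set X G \<phi> V}"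
    then obtain V where V: "adapted_set X G \<phi> V" "b = card (translates V)"
      by blast
    obtain g where g: "g \<in> carrier G" "x0 \<in> \<phi> g ` V"
      using adapted_cover[OF V(1) x0(1)] by blast
    note gV = adapted_translate[OF V(1) g(1)]
    obtain l where "U l \<subseteq> \<phi> g ` V"
      using nested_closed_subset_open[OF decU clopen(2) interU _ g(2)] gV
      unfolding adapted_set_def by blast
    \<comment> \<open>One level deeper, since the least common multiple runs over positive levels
      only.\<close>
    then have "U (Suc l) \<subseteq> \<phi> g ` V"
      using decseqD[OF decU, of l "Suc l"] by simp
    then have "b dvd card (lcosets (\<G> (Suc l)))"
      using card_translates_mult[OF gV adapted] translates_translate[OF g(1)] adapted_subset[OF V(1)] V
      by (metis card_U dvd_triv_left)
    then show "\<exists>a\<in>{card (lcosets (\<G> l)) |l. 0 < l}. b dvd a"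
      by blast
  next
    show "0 \<notin> {card (lcosets (\<G> l)) |l. 0 < l}"
      using card_translates_nonzero[OF adapted] by (auto simp flip: card_U)
    show "0 \<notin> {card (translates V) |V. adapted_set X G \<phi> V}"
      by (auto dest: card_translates_nonzero)
  qed
qed

section \<open>From nested adapted sets to a chain model\<close>

definition setwise_stabilizer :: "'a set \<Rightarrow> 'g set" where
  "setwise_stabilizer U = {g \<in> carrier G. \<phi> g ` U = U}"

text \<open>For adapted \<open>U\<close> this is the coset of the stabilizer that names the
  translate of \<open>U\<close> containing \<open>x\<close>; it gives one coordinate of the map into
  the chain limit.\<close>

definition transporter :: "'a set \<Rightarrow> 'a \<Rightarrow> 'g set" where
  "transporter U x = {g \<in> carrier G. x \<in> \<phi> g ` U}"

lemma subgroup_setwise_stabilizer: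
  assumes U: "U \<subseteq> topspace X"
  shows "subgroup (setwise_stabilizer U) G"
proof (rule subgroupI)
  show "setwise_stabilizer U \<subseteq> carrier G"
    unfolding setwise_stabilizer_def by blast
  show "setwise_stabilizer U \<noteq> {}"
    using image_one[OF U] unfolding setwise_stabilizer_def by blast
  show "inv g \<in> setwise_stabilizer U" if "g \<in> setwise_stabilizer U" for g
    using that image_inv_image[OF _ U, of g] unfolding setwise_stabilizer_def by simp
  show "g \<otimes> h \<in> setwise_stabilizer U"
    if "g \<in> setwise_stabilizer U" "h \<in> setwise_stabilizer U" for g h
    using that image_mult[OF _ _ U, of g h] unfolding setwise_stabilizer_def by simp
qed

text \<open>Two elements give the same translate exactly when \<open>inv g \<otimes> k\<close>
  stabilizes \<open>U\<close>, so cosets correspond to translates.\<close>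

lemma coset_setwise_stabilizer:
  assumes U: "U \<subseteq> topspace X" and g: "g \<in> carrier G"
  shows "g <# setwise_stabilizer U = {k \<in> carrier G. \<phi> k ` U = \<phi> g ` U}"
proof
  show "g <# setwise_stabilizer U \<subseteq> {k \<in> carrier G. \<phi> k ` U = \<phi> g ` U}"
  proof
    fix k assume "k \<in> g <# setwise_stabilizer U"
    then obtain s where "s \<in> carrier G" "\<phi> s ` U = U" "k = g \<otimes> s"
      unfolding l_coset_def setwise_stabilizer_def by blast
    then show "k \<in> {k \<in> carrier G. \<phi> k ` U = \<phi> g ` U}"
      using g image_mult[OF g _ U] by simp
  qed
  show "{k \<in> carrier G. \<phi> k ` U = \<phi> g ` U} \<subseteq> g <# setwise_stabilizer U"
  proof safe
    fix k assume k: "k \<in> carrier G" "\<phi> k ` U = \<phi> g ` U"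
    then have "inv g \<otimes> k \<in> setwise_stabilizer U"
      unfolding setwise_stabilizer_def using g U by (simp add: image_mult image_inv_image)
    then show "k \<in> g <# setwise_stabilizer U"
      using subgroup.lcos_module_rev[OF subgroup_setwise_stabilizer[OF U] is_group g k(1)] by blast
  qed
qed

lemma finite_lcosets_setwise_stabilizer:
  assumes U: "adapted_set X G \<phi> U"
  shows "finite (lcosets (setwise_stabilizer U))"
proof -
  have "lcosets (setwise_stabilizer U) = (\<lambda>T. {k \<in> carrier G. \<phi> k ` U = T}) ` translates U"
    unfolding LCOSETS_def translates_def
    using coset_setwise_stabilizer[OF adapted_subset[OF U]] by (auto simp: image_iff)
  then show ?thesis
    using finite_translates[OF U] by simp
qed

text \<open>All translates of \<open>U\<close> through \<open>x\<close> coincide, so the transporter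
  consists of the elements with the same translate as \<open>g\<close>.\<close>

lemma transporter_eq_coset:
  assumes U: "adapted_set X G \<phi> U" and g: "g \<in> carrier G" and x: "x \<in> \<phi> g ` U"
  shows "transporter U x = g <# setwise_stabilizer U"
proof -
  have "\<phi> k ` U = \<phi> g ` U \<longleftrightarrow> x \<in> \<phi> k ` U" if "k \<in> carrier G" for k
    using adapted_translates_meet[OF U that g] x by (metis IntI empty_iff)
  then show ?thesis
    unfolding transporter_def coset_setwise_stabilizer[OF adapted_subset[OF U] g] by blast
qed

lemma transporter_in_lcosets:
  assumes U: "adapted_set X G \<phi> U" and x: "x \<in> topspace X"
  shows "transporter U x \<in> lcosets (setwise_stabilizer U)"
  using adapted_cover[OF U x] transporter_eq_coset[OF U] unfolding LCOSETS_def by blast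

lemma transporter_act:
  assumes U: "adapted_set X G \<phi> U" and g: "g \<in> carrier G" and x: "x \<in> topspace X"
  shows "transporter U (\<phi> g x) = g <# transporter U x"
proof -
  note sub = adapted_subset[OF U]
  obtain k where k: "k \<in> carrier G" "x \<in> \<phi> k ` U"
    using adapted_cover[OF U x] by blast
  then have "\<phi> g x \<in> \<phi> (g \<otimes> k) ` U"
    using g sub by (simp add: image_mult)
  then have "transporter U (\<phi> g x) = (g \<otimes> k) <# setwise_stabilizer U"
    using transporter_eq_coset[OF U] g k by blast
  also have "\<dots> = g <# (k <# setwise_stabilizer U)"
    using g k subgroup.subset[OF subgroup_setwise_stabilizer[OF sub]] by (simp add: lcos_m_assoc)
  finally show ?thesis
    using transporter_eq_coset[OF U k] by simp
qed

text \<open>The map is locally constant: it has a single value on each translate of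
  \<open>U\<close>, and the translates are open and cover the space.\<close>

lemma continuous_map_transporter:
  assumes U: "adapted_set X G \<phi> U"
  shows "continuous_map X (discrete_topology (lcosets (setwise_stabilizer U))) (transporter U)"
proof -
  have "openin X {x \<in> topspace X. transporter U x \<in> S}" for S
  proof (subst openin_subopen, intro ballI)
    fix x assume x: "x \<in> {x \<in> topspace X. transporter U x \<in> S}"
    then obtain g where g: "g \<in> carrier G" "x \<in> \<phi> g ` U"
      using adapted_cover[OF U] by blast
    have "transporter U y = transporter U x" if "y \<in> \<phi> g ` U" for y
      using transporter_eq_coset[OF U g(1)] g(2) that by simp
    then have "\<phi> g ` U \<subseteq> {x \<in> topspace X. transporter U x \<in> S}"
      using x image_subset[OF g(1) adapted_subset[OF U]] by auto
    moreover have "openin X (\<phi> g ` U)"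
      using adapted_translate[OF U g(1)] unfolding adapted_set_def by blast
    ultimately show "\<exists>T. openin X T \<and> x \<in> T \<and> T \<subseteq> {x \<in> topspace X. transporter U x \<in> S}"
      using g(2) by blast
  qed
  then show ?thesis
    using transporter_in_lcosets[OF U] by (auto simp: continuous_map_def)
qed

text \<open>A point \<open>x\<close> of the limit is hit because the translates \<open>\<phi> (g l) ` U l\<close> with \<open>g l \<in> x l\<close> are nested.\<close>

lemma group_chain_model_of_adapted_sets:
  assumes U: "\<And>l. adapted_set X G \<phi> (U l)" and U0: "U 0 = topspace X" and dec: "decseq U"
    and separate: "\<And>x y g. \<forall>l. g l \<in> carrier G \<Longrightarrow>
        \<forall>l. x \<in> \<phi> (g l) ` U l \<Longrightarrow> \<forall>l. y \<in> \<phi> (g l) ` U l \<Longrightarrow> x = y"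
  shows "group_chain_model X G \<phi> (\<lambda>l. setwise_stabilizer (U l))"
proof -
  define \<G> where "\<G> l = setwise_stabilizer (U l)" for l
  \<comment> \<open>At each level \<open>h x\<close> records the translate containing
    \<open>x\<close>, encoded as a coset.\<close>
  define h where "h x = (\<lambda>l. transporter (U l) x)" for x
  note subU = adapted_subset[OF U]
  have sub: "subgroup (\<G> l) G" for l
    unfolding \<G>_def using subgroup_setwise_stabilizer[OF subU] .
  have U_Suc: "U (Suc l) \<subseteq> U l" for l
    using dec by (rule decseq_SucD)
  \<comment> \<open>Adaptedness makes the stabilizers decrease: an element fixing the nonempty set
    \<open>U (Suc l)\<close> moves \<open>U l\<close> to a set that meets
    \<open>U l\<close>.\<close>
  have dec\<G>: "\<G> (Suc l) \<subseteq> \<G> l" for l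
  proof
    fix g assume "g \<in> \<G> (Suc l)"
    then have g: "g \<in> carrier G" "\<phi> g ` U (Suc l) = U (Suc l)"
      unfolding \<G>_def setwise_stabilizer_def by auto
    moreover have "U (Suc l) \<noteq> {}"
      using U unfolding adapted_set_def by blast
    ultimately have "\<phi> g ` U l \<inter> U l \<noteq> {}"
      using U_Suc[of l] by (metis image_mono inf_mono subset_empty inf.idem)
    then have "\<phi> g ` U l = U l"
      using U[of l] g(1) unfolding adapted_set_def by simp
    then show "g \<in> \<G> l"
      using g(1) unfolding \<G>_def setwise_stabilizer_def by simp
  qed
  have "\<G> 0 = carrier G"
    unfolding \<G>_def U0 setwise_stabilizer_def using surj_prop by auto
  then have chain: "group_chain G \<G>"
    unfolding group_chain_def using sub dec\<G> finite_lcosets_setwise_stabilizer[OF U]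
    by (simp add: \<G>_def)
  have coset_quotient: "(g <# \<G> (Suc l)) <#> \<G> l = g <# \<G> l" if "g \<in> carrier G" for g l
    using that subgroup.subset[OF sub] subgroup_mult_absorb[OF sub sub dec\<G>]
    by (simp add: setmult_lcos_assoc)
  have h_coset: "h x l = g <# \<G> l" if "g \<in> carrier G" "x \<in> \<phi> g ` U l" for x g l
    unfolding h_def \<G>_def using transporter_eq_coset[OF U that] .
  have h_limit: "h x \<in> topspace (chain_limit G \<G>)" if x: "x \<in> topspace X" for x
  proof -
    have "h x l = h x (Suc l) <#> \<G> l" for l
    proof -
      obtain g where g: "g \<in> carrier G" "x \<in> \<phi> g ` U (Suc l)"
        using adapted_cover[OF U x] by blast
      then have "x \<in> \<phi> g ` U l"
        using U_Suc by blast
      then show ?thesis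
        using g by (simp add: h_coset coset_quotient)
    qed
    moreover have "h x l \<in> lcosets (\<G> l)" for l
      unfolding h_def \<G>_def using transporter_in_lcosets[OF U x] .
    ultimately show ?thesis
      unfolding topspace_chain_limit by blast
  qed
  have "continuous_map X (chain_limit G \<G>) h"
    unfolding chain_limit_def continuous_map_in_subtopology continuous_map_componentwise_UNIV
  proof (intro conjI allI)
    show "continuous_map X (discrete_topology (lcosets (\<G> l))) (\<lambda>x. h x l)" for l
      using continuous_map_transporter[OF U] unfolding h_def \<G>_def .
    show "h \<in> topspace X \<rightarrow> {x. \<forall>l. x l = chain_quotient_map G \<G> l (x (Suc l))}"
      using h_limit unfolding topspace_chain_limit chain_quotient_map_def by blast
  qed
  \<comment> \<open>With a compact source and a Hausdorff target, a continuous bijection is a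
    homeomorphism.\<close>
  moreover have "Hausdorff_space (chain_limit G \<G>)"
    unfolding chain_limit_def
    by (intro Hausdorff_space_subtopology) (simp add: Hausdorff_space_product_topology)
  moreover have "inj_on h (topspace X)"
  proof (rule inj_onI)
    fix x y assume x: "x \<in> topspace X" and y: "y \<in> topspace X" and eq: "h x = h y"
    obtain g where g: "\<forall>l. g l \<in> carrier G \<and> x \<in> \<phi> (g l) ` U l"
      using adapted_cover[OF U x] by metis
    \<comment> \<open>Equal coordinates put both points into the same translate at every level,
      which is the situation of \<open>separate\<close>.\<close>
    moreover have "g l \<in> transporter (U l) y" for l
      using fun_cong[OF eq, of l] g unfolding h_def transporter_def by blast
    ultimately show "x = y"
      using separate[of g x y] unfolding transporter_def by blast
  qed
  moreover have "h ` topspace X = topspace (chain_limit G \<G>)"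
  proof
    show "h ` topspace X \<subseteq> topspace (chain_limit G \<G>)"
      using h_limit by blast
    show "topspace (chain_limit G \<G>) \<subseteq> h ` topspace X"
    proof
      fix c assume "c \<in> topspace (chain_limit G \<G>)"
      then have "\<forall>l. c l \<in> lcosets (\<G> l)" and compat: "\<And>l. c l = c (Suc l) <#> \<G> l"
        unfolding topspace_chain_limit by blast+
      then have "\<forall>l. \<exists>g. g \<in> carrier G \<and> c l = g <# \<G> l"
        unfolding LCOSETS_def by blast
      then obtain g where g: "\<And>l. g l \<in> carrier G" "\<And>l. c l = g l <# \<G> l"
        by metis
      have nested: "\<phi> (g (Suc l)) ` U (Suc l) \<subseteq> \<phi> (g l) ` U l" for l
      proof -
        \<comment> \<open>Compatibility of \<open>c\<close> means that the representatives at levels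
          \<open>l\<close> and \<open>Suc l\<close> give the same translate of
          \<open>U l\<close>.\<close>
        have "g (Suc l) <# \<G> l = g l <# \<G> l"
          using compat[of l] g coset_quotient by simp
        then have "g (Suc l) \<in> g l <# \<G> l"
          using lcos_self[OF g(1) sub] by metis
        then have "\<phi> (g (Suc l)) ` U l = \<phi> (g l) ` U l"
          unfolding \<G>_def coset_setwise_stabilizer[OF subU g(1)] by blast
        then show ?thesis
          using U_Suc by blast
      qed
      have "(\<Inter>l. \<phi> (g l) ` U l) \<noteq> {}"
      proof (rule compact_space_imp_nest[OF compact])
        show "closedin X (\<phi> (g l) ` U l)" "\<phi> (g l) ` U l \<noteq> {}" for l
          using adapted_translate[OF U g(1)] unfolding adapted_set_def by auto
        show "decseq (\<lambda>l. \<phi> (g l) ` U l)"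
          using nested by (rule decseq_SucI)
      qed
      then obtain x where x: "\<And>l. x \<in> \<phi> (g l) ` U l"
        by blast
      then have "h x = c"
        using h_coset g by (intro ext) metis
      moreover have "x \<in> topspace X"
        using x[of 0] image_subset[OF g(1) subU] by blast
      ultimately show "c \<in> h ` topspace X"
        by blast
    qed
  qed
  ultimately have "homeomorphic_map X (chain_limit G \<G>) h"
    using compact by (intro continuous_imp_homeomorphic_map)
  moreover have "h (\<phi> g x) = chain_action G g (h x)" if "g \<in> carrier G" "x \<in> topspace X" for g x
    unfolding h_def chain_action_def using transporter_act[OF U that] by auto
  ultimately show ?thesis
    using chain unfolding group_chain_model_def \<G>_def by blast
qed

end

section \<open>Odometers\<close>

lemma odometer_imp_minimal_compact_action:
  assumes "odometer X G \<phi>"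
  shows "minimal_compact_action X G \<phi>"
proof -
  have "compact_space (product_topology (\<lambda>_::nat. discrete_topology (UNIV :: bool set)) UNIV)"
    by (simp add: compact_space_product_topology compact_space_discrete_topology)
  then have "compact_space X"
    using assms homeomorphic_compact_space
    unfolding odometer_def cantor_action_def cantor_space_def by blast
  then show ?thesis
    using assms unfolding odometer_def cantor_action_def minimal_compact_action_def
      minimal_compact_action_axioms_def by blast
qed

text \<open>The coordinates of the binary sequence space are pulled back along a homeomorphism. They
  supply the countably many clopen partitions behind the itineraries; nonemptiness supplies a base
  point.\<close>

lemma cantor_space_coordinates:
  assumes "cantor_space X"
  shows "\<exists>e :: nat \<Rightarrow> 'a \<Rightarrow> bool. (\<forall>i. continuous_map X (discrete_topology UNIV) (e i)) \<and>
    (\<forall>x\<in>topspace X. \<forall>y\<in>topspace X. (\<forall>i. e i x = e i y) \<longrightarrow> x = y)"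
    and "topspace X \<noteq> {}"
proof -
  obtain c where c: "homeomorphic_map X
      (product_topology (\<lambda>_::nat. discrete_topology (UNIV :: bool set)) UNIV) c"
    using assms unfolding cantor_space_def homeomorphic_space by blast
  have "continuous_map X (discrete_topology UNIV) (\<lambda>x. c x i)" for i
    using homeomorphic_imp_continuous_map[OF c] by (simp add: continuous_map_componentwise_UNIV)
  moreover have "x = y" if "x \<in> topspace X" "y \<in> topspace X" "\<forall>i. c x i = c y i" for x y
  proof -
    have "c x = c y"
      using that(3) by blast
    then show ?thesis
      using homeomorphic_imp_injective_map[OF c] that by (meson inj_onD)
  qed
  ultimately show "\<exists>e :: nat \<Rightarrow> 'a \<Rightarrow> bool. (\<forall>i. continuous_map X (discrete_topology UNIV) (e i)) \<and>
      (\<forall>x\<in>topspace X. \<forall>y\<in>topspace X. (\<forall>i. e i x = e i y) \<longrightarrow> x = y)"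
    by (intro exI[of _ "\<lambda>i x. c x i"]) blast
  show "topspace X \<noteq> {}"
    using homeomorphic_imp_surjective_map[OF c] by fastforce
qed

section \<open>Itinerary classes and the existence of chain models\<close>

context minimal_compact_action
begin

text \<open>A Lebesgue number \<open>\<epsilon>\<close> of the cover by \<open>W\<close> and its
  complement keeps \<open>\<epsilon>\<close>-close points on one side. Equicontinuity gives one
  \<open>\<delta>\<close> for all group elements, so whole itineraries are constant on
  \<open>\<delta>\<close>-balls.\<close>

lemma openin_same_itinerary:
  assumes equi: "equicontinuous_action X G \<phi>" and W: "openin X W" "closedin X W"
  shows "openin X {y \<in> topspace X. \<forall>g\<in>carrier G. \<phi> g y \<in> W \<longleftrightarrow> \<phi> g x \<in> W}" (is "openin X ?S")
proof -
  obtain d where metric: "Metric_space (topspace X) d" "Metric_space.mtopology (topspace X) d = X"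
    and equi': "\<forall>\<epsilon>>0. \<exists>\<delta>>0. \<forall>x\<in>topspace X. \<forall>y\<in>topspace X. d x y < \<delta> \<longrightarrow>
           (\<forall>g\<in>carrier G. d (\<phi> g x) (\<phi> g y) < \<epsilon>)"
    using equi unfolding equicontinuous_action_def by metis
  interpret M: Metric_space "topspace X" d
    by (fact metric(1))
  have "\<exists>\<epsilon>>0. \<forall>x\<in>topspace X. \<exists>U\<in>{W, topspace X - W}. M.mball x \<epsilon> \<subseteq> U"
  proof (rule M.lebesgue_number)
    show "compactin M.mtopology (topspace X)"
      using compact metric(2) unfolding compact_space_def by simp
    show "openin M.mtopology U" if "U \<in> {W, topspace X - W}" for U
      using that W metric(2) by auto
  qed auto
  then obtain \<epsilon> where "\<epsilon> > 0"
    and \<epsilon>: "\<And>x. x \<in> topspace X \<Longrightarrow> M.mball x \<epsilon> \<subseteq> W \<or> M.mball x \<epsilon> \<subseteq> topspace X - W"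
    by blast
  then obtain \<delta> where "\<delta> > 0" and \<delta>: "\<And>x y g. x \<in> topspace X \<Longrightarrow> y \<in> topspace X \<Longrightarrow> d x y < \<delta> \<Longrightarrow>
      g \<in> carrier G \<Longrightarrow> d (\<phi> g x) (\<phi> g y) < \<epsilon>"
    using equi' by metis
  have same: "\<phi> g z \<in> W \<longleftrightarrow> \<phi> g y \<in> W"
    if "y \<in> topspace X" "z \<in> M.mball y \<delta>" "g \<in> carrier G" for y z g
  proof -
    have "\<phi> g z \<in> M.mball (\<phi> g y) \<epsilon>" "\<phi> g y \<in> M.mball (\<phi> g y) \<epsilon>"
      using that \<delta>[of y z g] act_closed \<open>\<epsilon> > 0\<close> by auto
    then show ?thesis
      using \<epsilon>[OF act_closed[OF that(3,1)]] by blast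
  qed
  have "M.mball y \<delta> \<subseteq> ?S" if "y \<in> ?S" for y
    using same[of y] that by (auto simp: M.in_mball)
  then have "openin M.mtopology ?S"
    unfolding M.openin_mtopology using \<open>\<delta> > 0\<close> by blast
  then show ?thesis
    using metric(2) by simp
qed

text \<open>The classes of a \<open>G\<close>-invariant equivalence relation, which equicontinuity makes clopen.\<close>

definition itinerary_class :: "(nat \<Rightarrow> 'a \<Rightarrow> bool) \<Rightarrow> nat \<Rightarrow> 'a \<Rightarrow> 'a set" where
  "itinerary_class e n x =
     {y \<in> topspace X. \<forall>g\<in>carrier G. \<forall>i<n. e i (\<phi> g y) = e i (\<phi> g x)}"

lemma itinerary_class_eqI: "y \<in> itinerary_class e n x \<Longrightarrow> itinerary_class e n y = itinerary_class e n x"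
  unfolding itinerary_class_def by auto

lemma self_in_itinerary_class: "x \<in> topspace X \<Longrightarrow> x \<in> itinerary_class e n x"
  unfolding itinerary_class_def by auto

text \<open>Comparing \<open>\<phi> g y\<close> with \<open>\<phi> g x\<close> at \<open>k\<close>
  is comparing \<open>y\<close> with \<open>x\<close> at \<open>k \<otimes> g\<close>. The reverse
  inclusion is the forward one applied to \<open>inv g\<close>.\<close>

lemma image_itinerary_class:
  assumes g: "g \<in> carrier G" and x: "x \<in> topspace X"
  shows "\<phi> g ` itinerary_class e n x = itinerary_class e n (\<phi> g x)"
proof -
  have sub: "\<phi> g ` itinerary_class e n x \<subseteq> itinerary_class e n (\<phi> g x)"
    if g: "g \<in> carrier G" and x: "x \<in> topspace X" for g x
  proof clarify
    fix y assume y: "y \<in> itinerary_class e n x"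
    have "e i (\<phi> k (\<phi> g y)) = e i (\<phi> k (\<phi> g x))" if "k \<in> carrier G" "i < n" for k i
    proof -
      have "e i (\<phi> (k \<otimes> g) y) = e i (\<phi> (k \<otimes> g) x)"
        using y g that unfolding itinerary_class_def by simp
      then show ?thesis
        using y x g that unfolding itinerary_class_def by (simp add: composition_rule)
    qed
    then show "\<phi> g y \<in> itinerary_class e n (\<phi> g x)"
      using y g act_closed unfolding itinerary_class_def by blast
  qed
  moreover have "itinerary_class e n (\<phi> g x) \<subseteq> \<phi> g ` itinerary_class e n x"
  proof
    fix y assume y: "y \<in> itinerary_class e n (\<phi> g x)"
    then have "\<phi> (inv g) y \<in> itinerary_class e n x"
      using sub[of "inv g" "\<phi> g x"] g x act_closed act_inv_act by auto
    moreover have "y \<in> topspace X"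
      using y unfolding itinerary_class_def by blast
    ultimately show "y \<in> \<phi> g ` itinerary_class e n x"
      using act_act_inv[OF g] by (metis imageI)
  qed
  ultimately show ?thesis
    using g x by blast
qed

lemma openin_itinerary_class:
  assumes equi: "equicontinuous_action X G \<phi>"
    and e: "\<And>i. continuous_map X (discrete_topology UNIV) (e i)" and x: "x \<in> topspace X"
  shows "openin X (itinerary_class e n x)"
proof (induction n)
  case 0
  then show ?case
    unfolding itinerary_class_def by simp
next
  case (Suc n)
  \<comment> \<open>The set where the next coordinate is true is clopen; its itineraries cut the
    class of level \<open>n\<close> down to level \<open>Suc n\<close>.\<close>
  define W where "W = {y \<in> topspace X. e n y \<in> {True}}"
  have W: "openin X W" "closedin X W"
    unfolding W_def
    by (rule openin_continuous_map_preimage[OF e] closedin_continuous_map_preimage[OF e]; simp)+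
  have eq: "itinerary_class e (Suc n) x = itinerary_class e n x \<inter>
      {y \<in> topspace X. \<forall>g\<in>carrier G. \<phi> g y \<in> W \<longleftrightarrow> \<phi> g x \<in> W}"
    using act_closed x unfolding itinerary_class_def W_def by (auto simp: less_Suc_eq)
  show ?case
    unfolding eq using Suc openin_same_itinerary[OF equi W] by (rule openin_Int)
qed

text \<open>The complement is a union of open classes, so a class is also closed. The group permutes
  the classes, and these are equal or disjoint.\<close>

lemma adapted_itinerary_class:
  assumes equi: "equicontinuous_action X G \<phi>"
    and e: "\<And>i. continuous_map X (discrete_topology UNIV) (e i)" and x: "x \<in> topspace X"
  shows "adapted_set X G \<phi> (itinerary_class e n x)"
proof -
  let ?C = "itinerary_class e n"
  have "topspace X - ?C x = \<Union>(?C ` (topspace X - ?C x))"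
  proof
    show "topspace X - ?C x \<subseteq> \<Union>(?C ` (topspace X - ?C x))"
      using self_in_itinerary_class by blast
    show "\<Union>(?C ` (topspace X - ?C x)) \<subseteq> topspace X - ?C x"
      unfolding itinerary_class_def by auto
  qed
  moreover have "openin X (\<Union>(?C ` (topspace X - ?C x)))"
    using openin_itinerary_class[OF equi e] by (intro openin_Union) auto
  ultimately have "openin X (topspace X - ?C x)"
    by simp
  moreover have open_C: "openin X (?C x)"
    using openin_itinerary_class[OF equi e x] .
  ultimately have "closedin X (?C x)"
    using openin_subset by (simp add: closedin_def)
  moreover have "\<phi> g ` ?C x = ?C x" if g: "g \<in> carrier G" and meet: "\<phi> g ` ?C x \<inter> ?C x \<noteq> {}" for g
  proof -
    have eq: "\<phi> g ` ?C x = ?C (\<phi> g x)"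
      by (rule image_itinerary_class[OF g x])
    then obtain y where "y \<in> ?C (\<phi> g x)" "y \<in> ?C x"
      using meet by blast
    then show ?thesis
      using itinerary_class_eqI[of y e n x] itinerary_class_eqI[of y e n "\<phi> g x"] eq by simp
  qed
  moreover have "?C x \<noteq> {}"
    using self_in_itinerary_class[OF x] by blast
  ultimately show ?thesis
    using open_C unfolding adapted_set_def by simp
qed

text \<open>The nested classes of one base point feed the construction from adapted sets. Level 0
  tests no coordinate and gives the whole space.\<close>

lemma group_chain_model_exists:
  assumes cantor: "cantor_space X" and equi: "equicontinuous_action X G \<phi>"
  shows "\<exists>\<G>. group_chain_model X G \<phi> \<G>"
proof -
  obtain e :: "nat \<Rightarrow> 'a \<Rightarrow> bool"
    where e: "\<And>i. continuous_map X (discrete_topology UNIV) (e i)"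
      and separate: "\<And>x y. x \<in> topspace X \<Longrightarrow> y \<in> topspace X \<Longrightarrow> (\<And>i. e i x = e i y) \<Longrightarrow> x = y"
    using cantor_space_coordinates(1)[OF cantor] by blast
  obtain x0 where x0: "x0 \<in> topspace X"
    using cantor_space_coordinates(2)[OF cantor] by blast
  have "group_chain_model X G \<phi> (\<lambda>l. setwise_stabilizer (itinerary_class e l x0))"
  proof (rule group_chain_model_of_adapted_sets)
    show "adapted_set X G \<phi> (itinerary_class e l x0)" for l
      using adapted_itinerary_class[OF equi e x0] .
    show "itinerary_class e 0 x0 = topspace X"
      unfolding itinerary_class_def by simp
    show "decseq (\<lambda>l. itinerary_class e l x0)"
      unfolding itinerary_class_def by (rule decseq_SucI) auto
    show "x = y"
      if g: "\<forall>l. g l \<in> carrier G" and x: "\<forall>l. x \<in> \<phi> (g l) ` itinerary_class e l x0"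
        and y: "\<forall>l. y \<in> \<phi> (g l) ` itinerary_class e l x0" for x y g
    proof (rule separate)
      have *: "x \<in> itinerary_class e l (\<phi> (g l) x0)" "y \<in> itinerary_class e l (\<phi> (g l) x0)" for l
        using g x y image_itinerary_class[OF _ x0] by blast+
      then show top: "x \<in> topspace X" "y \<in> topspace X"
        unfolding itinerary_class_def by blast+
      \<comment> \<open>Coordinate \<open>i\<close> is first tested at level \<open>Suc i\<close>;
        testing it at the identity compares the points themselves.\<close>
      have "e i (\<phi> \<one> x) = e i (\<phi> \<one> y)" for i
        using *[of "Suc i"] one_closed unfolding itinerary_class_def by auto
      then show "e i x = e i y" for i
        using top act_one by simp
    qed
  qed
  then show ?thesis
    by blast
qed

end

section \<open>Return equivalence\<close>

context minimal_compact_action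
begin

text \<open>By \<open>refine_adapted\<close>, adapted subsets of \<open>U\<close> suffice for the
  least common multiple, and \<open>card_translates_mult\<close> splits a constant factor off their
  counts. What remains depends only on the action of the return set on \<open>U\<close>.\<close>

lemma adapted_order_eq_scale:
  assumes U: "adapted_set X G \<phi> U"
  shows "adapted_order = steinitz_scale (card (translates U))
    (steinitz_lcm {card (return_translates U V) | V. adapted_set X G \<phi> V \<and> V \<subseteq> U})"
    (is "_ = steinitz_scale ?n (steinitz_lcm ?M)")
proof -
  have mult: "card (translates V) = ?n * card (return_translates U V)"
    if "adapted_set X G \<phi> V" "V \<subseteq> U" for V
    using card_translates_mult[OF U that] .
  have "card (return_translates U V) \<noteq> 0" if "adapted_set X G \<phi> V" "V \<subseteq> U" for V
    using mult[OF that] card_translates_nonzero[OF that(1)] by (metis mult_0_right)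
  then have "0 \<notin> ?M"
    by fastforce
  moreover have "?M \<noteq> {}"
    using U by blast
  ultimately have "steinitz_scale ?n (steinitz_lcm ?M) = steinitz_lcm ((*) ?n ` ?M)"
    by (intro steinitz_scale_lcm card_translates_nonzero[OF U])
  also have "(*) ?n ` ?M = {card (translates V) | V. adapted_set X G \<phi> V \<and> V \<subseteq> U}"
  proof -
    have "?M = (\<lambda>V. card (return_translates U V)) ` {V. adapted_set X G \<phi> V \<and> V \<subseteq> U}"
      "{card (translates V) | V. adapted_set X G \<phi> V \<and> V \<subseteq> U} =
        (\<lambda>V. card (translates V)) ` {V. adapted_set X G \<phi> V \<and> V \<subseteq> U}"
      by blast+
    then show ?thesis
      using mult by (simp add: image_image)
  qed
  also have "steinitz_lcm \<dots> = adapted_order"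
    unfolding adapted_order_def
  proof (rule steinitz_lcm_eqI)
    fix a assume "a \<in> {card (translates V) | V. adapted_set X G \<phi> V \<and> V \<subseteq> U}"
    then show "\<exists>b\<in>{card (translates V) | V. adapted_set X G \<phi> V}. a dvd b"
      using dvd_refl by blast
  next
    fix b assume "b \<in> {card (translates V) | V. adapted_set X G \<phi> V}"
    then obtain W where W: "adapted_set X G \<phi> W" "b = card (translates W)"
      by blast
    obtain V where "adapted_set X G \<phi> V" "V \<subseteq> U" "card (translates W) dvd card (translates V)"
      by (rule refine_adapted[OF U W(1)])
    then show "\<exists>a\<in>{card (translates V) | V. adapted_set X G \<phi> V \<and> V \<subseteq> U}. b dvd a"
      using W by blast
  next
    show "0 \<notin> {card (translates V) | V. adapted_set X G \<phi> V}"
      by (auto dest: card_translates_nonzero)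
    then show "0 \<notin> {card (translates V) | V. adapted_set X G \<phi> V \<and> V \<subseteq> U}"
      by blast
  qed
  finally show ?thesis
    by simp
qed

lemma return_set_closed:
  assumes "adapted_set X G \<phi> U" "g \<in> return_set G \<phi> U" "x \<in> U"
  shows "\<phi> g x \<in> U"
proof -
  have "\<phi> g ` U = U"
    using assms unfolding adapted_set_def return_set_def by simp
  then show ?thesis
    using assms(3) by blast
qed

end

text \<open>
  The isomorphism of holonomy groups is forgotten: only the families of maps of \<open>U\<close> and \<open>U'\<close>
  matter for the translates of adapted subsets.
\<close>

definition holonomy_conjugate ::
  "'a topology \<Rightarrow> ('g, 'm) monoid_scheme \<Rightarrow> ('g \<Rightarrow> 'a \<Rightarrow> 'a) \<Rightarrow> 'a set \<Rightarrow>
   'b topology \<Rightarrow> ('h, 'n) monoid_scheme \<Rightarrow> ('h \<Rightarrow> 'b \<Rightarrow> 'b) \<Rightarrow> 'b set \<Rightarrow>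
   ('a \<Rightarrow> 'b) \<Rightarrow> ('b \<Rightarrow> 'a) \<Rightarrow> bool" where
  "holonomy_conjugate X G \<phi> U X' G' \<phi>' U' h k \<longleftrightarrow>
     homeomorphic_maps (subtopology X U) (subtopology X' U') h k \<and>
     (\<forall>g\<in>return_set G \<phi> U. \<exists>g'\<in>return_set G' \<phi>' U'. \<forall>x\<in>U. h (\<phi> g x) = \<phi>' g' (h x)) \<and>
     (\<forall>g'\<in>return_set G' \<phi>' U'. \<exists>g\<in>return_set G \<phi> U. \<forall>y\<in>U'. k (\<phi>' g' y) = \<phi> g (k y))"

lemma holonomy_conjugate_sym:
  "holonomy_conjugate X G \<phi> U X' G' \<phi>' U' h k \<Longrightarrow> holonomy_conjugate X' G' \<phi>' U' X G \<phi> U k h"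
  unfolding holonomy_conjugate_def
  using homeomorphic_maps_sym[of "subtopology X U" "subtopology X' U'" h k] by blast

text \<open>Elements of the holonomy groups are restrictions of return elements. Applying
  \<open>\<Theta>\<close> to the restriction of \<open>\<phi> g\<close> yields \<open>g'\<close>;
  surjectivity of \<open>\<Theta>\<close> yields \<open>g\<close> from \<open>g'\<close>.\<close>

lemma holonomy_conjugate_of_isomorphic:
  assumes "minimal_compact_action X G \<phi>" and "minimal_compact_action X' G' \<phi>'"
    and U: "adapted_set X G \<phi> U" and U': "adapted_set X' G' \<phi>' U'"
    and iso: "isomorphic_actions
          (subtopology X U) (holonomy_group G \<phi> U) (\<lambda>f. f)
          (subtopology X' U') (holonomy_group G' \<phi>' U') (\<lambda>f. f)"
  shows "\<exists>h k. holonomy_conjugate X G \<phi> U X' G' \<phi>' U' h k"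
proof -
  interpret A: minimal_compact_action X G \<phi>
    by (fact assms(1))
  interpret A': minimal_compact_action X' G' \<phi>'
    by (fact assms(2))
  have carrier: "carrier (holonomy_group G \<phi> U) = (\<lambda>g. restrict (\<phi> g) U) ` return_set G \<phi> U"
    "carrier (holonomy_group G' \<phi>' U') = (\<lambda>g. restrict (\<phi>' g) U') ` return_set G' \<phi>' U'"
    unfolding holonomy_group_def by simp_all
  have top: "topspace (subtopology X U) = U" "topspace (subtopology X' U') = U'"
    using A.adapted_subset[OF U] A'.adapted_subset[OF U'] by auto
  obtain h k \<Theta> where maps: "homeomorphic_maps (subtopology X U) (subtopology X' U') h k"
    and \<Theta>: "\<Theta> \<in> iso (holonomy_group G \<phi> U) (holonomy_group G' \<phi>' U')"
    and conj: "\<forall>f\<in>carrier (holonomy_group G \<phi> U). \<forall>x\<in>U. f x = k ((\<Theta> f) (h x))"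
    using iso unfolding isomorphic_actions_def top by blast
  have h: "h x \<in> U'" "k (h x) = x" if "x \<in> U" for x
    using maps that unfolding homeomorphic_maps_def top continuous_map_def by auto
  have k: "k y \<in> U" "h (k y) = y" if "y \<in> U'" for y
    using maps that unfolding homeomorphic_maps_def top continuous_map_def by auto
  have \<Theta>_onto: "\<Theta> ` carrier (holonomy_group G \<phi> U) = carrier (holonomy_group G' \<phi>' U')"
    using \<Theta> unfolding iso_def bij_betw_def by blast
  have "\<exists>g'\<in>return_set G' \<phi>' U'. \<forall>x\<in>U. h (\<phi> g x) = \<phi>' g' (h x)" if g: "g \<in> return_set G \<phi> U" for g
  proof -
    have f: "restrict (\<phi> g) U \<in> carrier (holonomy_group G \<phi> U)"
      using g carrier by blast
    then have "\<Theta> (restrict (\<phi> g) U) \<in> carrier (holonomy_group G' \<phi>' U')"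
      using \<Theta>_onto by blast
    then obtain g' where g': "g' \<in> return_set G' \<phi>' U'" "\<Theta> (restrict (\<phi> g) U) = restrict (\<phi>' g') U'"
      unfolding carrier by blast
    have "h (\<phi> g x) = \<phi>' g' (h x)" if x: "x \<in> U" for x
    proof -
      have "\<phi> g x = k (\<phi>' g' (h x))"
        using conj[rule_format, OF f x] x h g' by simp
      \<comment> \<open>Return elements keep \<open>h x\<close> inside \<open>U'\<close>, where
        \<open>h\<close> undoes \<open>k\<close>.\<close>
      then show ?thesis
        using k(2)[OF A'.return_set_closed[OF U' g'(1) h(1)[OF x]]] by simp
    qed
    then show ?thesis
      using g' by blast
  qed
  moreover have "\<exists>g\<in>return_set G \<phi> U. \<forall>y\<in>U'. k (\<phi>' g' y) = \<phi> g (k y)"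
    if g': "g' \<in> return_set G' \<phi>' U'" for g'
  proof -
    have "restrict (\<phi>' g') U' \<in> \<Theta> ` carrier (holonomy_group G \<phi> U)"
      unfolding \<Theta>_onto using g' carrier by blast
    then obtain f where f: "f \<in> carrier (holonomy_group G \<phi> U)" "\<Theta> f = restrict (\<phi>' g') U'"
      by force
    then obtain g where g: "g \<in> return_set G \<phi> U" "f = restrict (\<phi> g) U"
      unfolding carrier by blast
    have "k (\<phi>' g' y) = \<phi> g (k y)" if y: "y \<in> U'" for y
      using conj[rule_format, OF f(1) k(1)[OF y]] f(2) g(2) y k by simp
    then show ?thesis
      using g by blast
  qed
  ultimately show ?thesis
    using maps unfolding holonomy_conjugate_def by blast
qed

text \<open>The conjugacy matches the return translates of \<open>V\<close> with those of its image,
  injectively since \<open>h\<close> is injective on \<open>U\<close>. For adaptedness, an element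
  making the image meet itself is a return element of \<open>U'\<close>, so the conjugacy applies to
  it.\<close>

lemma holonomy_conjugate_adapted:
  assumes "minimal_compact_action X G \<phi>" and "minimal_compact_action X' G' \<phi>'"
    and U: "adapted_set X G \<phi> U" and U': "adapted_set X' G' \<phi>' U'"
    and conj: "holonomy_conjugate X G \<phi> U X' G' \<phi>' U' h k"
    and V: "adapted_set X G \<phi> V" and VU: "V \<subseteq> U"
  shows "adapted_set X' G' \<phi>' (h ` V)" and "h ` V \<subseteq> U'"
    and "card (minimal_compact_action.return_translates G' \<phi>' U' (h ` V)) =
      card (minimal_compact_action.return_translates G \<phi> U V)"
proof -
  interpret A: minimal_compact_action X G \<phi>
    by (fact assms(1))
  interpret A': minimal_compact_action X' G' \<phi>'
    by (fact assms(2))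
  have top: "topspace (subtopology X U) = U" "topspace (subtopology X' U') = U'"
    using A.adapted_subset[OF U] A'.adapted_subset[OF U'] by auto
  have maps: "homeomorphic_maps (subtopology X U) (subtopology X' U') h k"
    using conj unfolding holonomy_conjugate_def by blast
  have h: "h x \<in> U'" "k (h x) = x" if "x \<in> U" for x
    using maps that unfolding homeomorphic_maps_def top continuous_map_def by auto
  have k: "k y \<in> U" "h (k y) = y" if "y \<in> U'" for y
    using maps that unfolding homeomorphic_maps_def top continuous_map_def by auto
  have inj: "inj_on h U"
    using h(2) by (rule inj_on_inverseI)
  show sub: "h ` V \<subseteq> U'"
    using h VU by blast
  have image: "\<phi>' g' ` h ` V = h ` \<phi> g ` V" if "\<forall>x\<in>U. h (\<phi> g x) = \<phi>' g' (h x)" for g g'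
    unfolding image_image using that VU by (intro image_cong) auto
  have lift: "\<exists>g'\<in>return_set G' \<phi>' U'. \<phi>' g' ` h ` V = h ` \<phi> g ` V" if "g \<in> return_set G \<phi> U" for g
    using conj that image unfolding holonomy_conjugate_def by blast
  have lower: "\<exists>g\<in>return_set G \<phi> U. \<phi>' g' ` h ` V = h ` \<phi> g ` V" if g': "g' \<in> return_set G' \<phi>' U'" for g'
  proof -
    obtain g where g: "g \<in> return_set G \<phi> U" "\<forall>y\<in>U'. k (\<phi>' g' y) = \<phi> g (k y)"
      using conj g' unfolding holonomy_conjugate_def by blast
    have "h (\<phi> g x) = \<phi>' g' (h x)" if x: "x \<in> U" for x
    proof -
      have "\<phi> g x = k (\<phi>' g' (h x))"
        using g(2) h[OF x] by simp
      then show ?thesis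
        using k(2)[OF A'.return_set_closed[OF U' g' h(1)[OF x]]] by simp
    qed
    then show ?thesis
      using image g(1) by blast
  qed
  have return_sub: "\<phi> g ` V \<subseteq> U" if "g \<in> return_set G \<phi> U" for g
    using A.return_set_closed[OF U that] VU by blast
  show "adapted_set X' G' \<phi>' (h ` V)"
    unfolding adapted_set_def
  proof (intro conjI ballI impI)
    show "h ` V \<noteq> {}"
      using V unfolding adapted_set_def by simp
    have hmap: "homeomorphic_map (subtopology X U) (subtopology X' U') h"
      using maps homeomorphic_maps_map by blast
    have clopen: "openin X U" "closedin X U" "openin X' U'" "closedin X' U'"
      using U U' unfolding adapted_set_def by auto
    \<comment> \<open>Since \<open>U\<close> and \<open>U'\<close> are clopen, a subset is clopen in
      the subspace exactly when it is clopen in the whole space.\<close>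
    have "openin (subtopology X U) V" "closedin (subtopology X U) V"
      using V VU unfolding adapted_set_def
      by (auto simp: openin_open_subtopology[OF clopen(1)] closedin_closed_subtopology[OF clopen(2)])
    then have "openin (subtopology X' U') (h ` V)" "closedin (subtopology X' U') (h ` V)"
      using homeomorphic_map_openness[OF hmap] homeomorphic_map_closedness[OF hmap] VU
        A.adapted_subset[OF V] by simp_all
    then show "openin X' (h ` V)" "closedin X' (h ` V)"
      by (auto simp: openin_open_subtopology[OF clopen(3)] closedin_closed_subtopology[OF clopen(4)])
    fix g' assume g': "g' \<in> carrier G'" "\<phi>' g' ` h ` V \<inter> h ` V \<noteq> {}"
    then have "g' \<in> return_set G' \<phi>' U'"
      using sub unfolding return_set_def by blast
    then obtain g where g: "g \<in> return_set G \<phi> U" "\<phi>' g' ` h ` V = h ` \<phi> g ` V"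
      using lower by blast
    \<comment> \<open>Injectivity of \<open>h\<close> pulls the intersection of the images back to
      \<open>U\<close>.\<close>
    have "\<phi> g ` V \<inter> V \<noteq> {}"
      using g'(2) inj_on_image_Int[OF inj return_sub[OF g(1)] VU] unfolding g(2) by (metis image_empty)
    then have "\<phi> g ` V = V"
      using V g(1) unfolding adapted_set_def return_set_def by simp
    then show "\<phi>' g' ` h ` V = h ` V"
      using g by simp
  qed
  have image_translates: "A'.return_translates U' (h ` V) = (`) h ` A.return_translates U V"
  proof
    show "A'.return_translates U' (h ` V) \<subseteq> (`) h ` A.return_translates U V"
    proof
      fix T assume "T \<in> A'.return_translates U' (h ` V)"
      then obtain g' where "g' \<in> return_set G' \<phi>' U'" "T = \<phi>' g' ` h ` V"
        unfolding A'.return_translates_def by blast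
      then show "T \<in> (`) h ` A.return_translates U V"
        unfolding A.return_translates_def using lower by (metis imageI)
    qed
    show "(`) h ` A.return_translates U V \<subseteq> A'.return_translates U' (h ` V)"
    proof clarify
      fix T assume "T \<in> A.return_translates U V"
      then obtain g where "g \<in> return_set G \<phi> U" "T = \<phi> g ` V"
        unfolding A.return_translates_def by blast
      then show "h ` T \<in> A'.return_translates U' (h ` V)"
        unfolding A'.return_translates_def using lift by (metis imageI)
    qed
  qed
  have "A.return_translates U V \<subseteq> Pow U"
    unfolding A.return_translates_def using return_sub by blast
  then have "inj_on ((`) h) (A.return_translates U V)"
    using inj_on_image_Pow[OF inj] inj_on_subset by blast
  then show "card (A'.return_translates U' (h ` V)) = card (A.return_translates U V)"
    unfolding image_translates by (rule card_image)
qed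

text \<open>Transfer in both directions shows that the counts inside \<open>U\<close> and inside
  \<open>U'\<close> form the same set. Both orders are then multiples of one Steinitz number, by
  \<open>n\<close> and \<open>n'\<close>, and scaling crosswise makes them equal.\<close>

lemma return_equivalent_adapted_order:
  assumes A: "minimal_compact_action X G \<phi>" and A': "minimal_compact_action X' G' \<phi>'"
    and return_eq: "return_equivalent X G \<phi> X' G' \<phi>'"
  shows "steinitz_asymp_equiv (minimal_compact_action.adapted_order X G \<phi>)
    (minimal_compact_action.adapted_order X' G' \<phi>')"
proof -
  interpret A: minimal_compact_action X G \<phi>
    by (fact A)
  interpret A': minimal_compact_action X' G' \<phi>'
    by (fact A')
  obtain U U' where U: "adapted_set X G \<phi> U" and U': "adapted_set X' G' \<phi>' U'"
    and iso: "isomorphic_actions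
          (subtopology X U) (holonomy_group G \<phi> U) (\<lambda>f. f)
          (subtopology X' U') (holonomy_group G' \<phi>' U') (\<lambda>f. f)"
    using return_eq unfolding return_equivalent_def by blast
  obtain h k where conj: "holonomy_conjugate X G \<phi> U X' G' \<phi>' U' h k"
    using holonomy_conjugate_of_isomorphic[OF A A' U U' iso] by blast
  define M where "M = {card (A.return_translates U V) | V. adapted_set X G \<phi> V \<and> V \<subseteq> U}"
  define M' where "M' = {card (A'.return_translates U' V) | V. adapted_set X' G' \<phi>' V \<and> V \<subseteq> U'}"
  have "M \<subseteq> M'"
  proof
    fix m assume "m \<in> M"
    then obtain V where V: "adapted_set X G \<phi> V" "V \<subseteq> U" "m = card (A.return_translates U V)"
      unfolding M_def by blast
    show "m \<in> M'"
      using holonomy_conjugate_adapted[OF A A' U U' conj V(1,2)] V(3) unfolding M'_def by force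
  qed
  moreover have "M' \<subseteq> M"
  proof
    fix m assume "m \<in> M'"
    then obtain V where V: "adapted_set X' G' \<phi>' V" "V \<subseteq> U'" "m = card (A'.return_translates U' V)"
      unfolding M'_def by blast
    show "m \<in> M"
      using holonomy_conjugate_adapted[OF A' A U' U holonomy_conjugate_sym[OF conj] V(1,2)] V(3)
      unfolding M_def by force
  qed
  ultimately have "M = M'"
    by blast
  define n n' where "n = card (A.translates U)" and "n' = card (A'.translates U')"
  have "n \<noteq> 0" "n' \<noteq> 0"
    using A.card_translates_nonzero[OF U] A'.card_translates_nonzero[OF U'] unfolding n_def n'_def .
  moreover have "A.adapted_order = steinitz_scale n (steinitz_lcm M)"
    "A'.adapted_order = steinitz_scale n' (steinitz_lcm M)"
    using A.adapted_order_eq_scale[OF U] A'.adapted_order_eq_scale[OF U'] \<open>M = M'\<close>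
    unfolding n_def n'_def M_def M'_def by simp_all
  ultimately have "steinitz_scale n' A.adapted_order = steinitz_scale n A'.adapted_order"
    by (simp add: steinitz_scale_scale mult.commute)
  then show ?thesis
    using \<open>n \<noteq> 0\<close> \<open>n' \<noteq> 0\<close> unfolding steinitz_asymp_equiv_def by (metis One_nat_def Suc_leI not_gr0)
qed

section \<open>The Steinitz order of an odometer\<close>

lemma odometer_group_chain_model_exists:
  assumes "odometer X G \<phi>"
  shows "\<exists>\<G>. group_chain_model X G \<phi> \<G>"
proof (rule minimal_compact_action.group_chain_model_exists)
  show "minimal_compact_action X G \<phi>"
    using odometer_imp_minimal_compact_action[OF assms] .
  show "cantor_space X" "equicontinuous_action X G \<phi>"
    using assms unfolding odometer_def cantor_action_def by simp_all
qed

text \<open>The definite description denotes because some model exists and all models give the same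
  value.\<close>

lemma steinitz_order_eq_adapted_order:
  assumes "odometer X G \<phi>"
  shows "steinitz_order X G \<phi> = minimal_compact_action.adapted_order X G \<phi>"
proof -
  obtain \<G> where \<G>: "group_chain_model X G \<phi> \<G>"
    using odometer_group_chain_model_exists[OF assms] by (rule exE)
  note order = minimal_compact_action.chain_steinitz_eq_adapted_order
    [OF odometer_imp_minimal_compact_action[OF assms]]
  show ?thesis
    unfolding steinitz_order_def
  proof (rule the_equality)
    show "\<exists>\<G>. group_chain_model X G \<phi> \<G> \<and> minimal_compact_action.adapted_order X G \<phi> = chain_steinitz G \<G>"
      using \<G> order[OF \<G>] by (intro exI[of _ \<G>]) simp
    show "\<xi> = minimal_compact_action.adapted_order X G \<phi>"
      if "\<exists>\<G>. group_chain_model X G \<phi> \<G> \<and> \<xi> = chain_steinitz G \<G>" for \<xi>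
      using that by (elim exE conjE) (simp add: order)
  qed
qed

theorem theorem1p5:
  fixes X :: "'a topology" and G :: "('g, 'm) monoid_scheme" and \<phi> :: "'g \<Rightarrow> 'a \<Rightarrow> 'a"
  assumes "odometer X G \<phi>"
  shows "(\<forall>\<G> \<G>'. group_chain_model X G \<phi> \<G> \<and> group_chain_model X G \<phi> \<G>' \<longrightarrow>
            chain_steinitz G \<G> = chain_steinitz G \<G>') \<and>
         (\<exists>\<G>. group_chain_model X G \<phi> \<G>) \<and>
         (\<forall>\<G>. group_chain_model X G \<phi> \<G> \<longrightarrow> steinitz_order X G \<phi> = chain_steinitz G \<G>) \<and>
         (\<forall>(X' :: 'b topology) (G' :: ('h, 'n) monoid_scheme) (\<phi>' :: 'h \<Rightarrow> 'b \<Rightarrow> 'b).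
            odometer X' G' \<phi>' \<and> return_equivalent X G \<phi> X' G' \<phi>' \<longrightarrow>
            steinitz_type (steinitz_order X G \<phi>) = steinitz_type (steinitz_order X' G' \<phi>'))"
proof (intro conjI allI impI)
  note action = odometer_imp_minimal_compact_action[OF assms]
  note order = minimal_compact_action.chain_steinitz_eq_adapted_order[OF action]
  show "chain_steinitz G \<G> = chain_steinitz G \<G>'"
    if "group_chain_model X G \<phi> \<G> \<and> group_chain_model X G \<phi> \<G>'" for \<G> \<G>'
    using that order[of \<G>] order[of \<G>'] by simp
  show "\<exists>\<G>. group_chain_model X G \<phi> \<G>"
    using odometer_group_chain_model_exists[OF assms] .
  show "steinitz_order X G \<phi> = chain_steinitz G \<G>" if "group_chain_model X G \<phi> \<G>" for \<G>
    using order[OF that] steinitz_order_eq_adapted_order[OF assms] by simp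
  show "steinitz_type (steinitz_order X G \<phi>) = steinitz_type (steinitz_order X' G' \<phi>')"
    if "odometer X' G' \<phi>' \<and> return_equivalent X G \<phi> X' G' \<phi>'"
    for X' :: "'b topology" and G' :: "('h, 'n) monoid_scheme" and \<phi>' :: "'h \<Rightarrow> 'b \<Rightarrow> 'b"
  proof -
    have "odometer X' G' \<phi>'" "return_equivalent X G \<phi> X' G' \<phi>'"
      using that by auto
    then have "steinitz_asymp_equiv (steinitz_order X G \<phi>) (steinitz_order X' G' \<phi>')"
      using return_equivalent_adapted_order[OF action odometer_imp_minimal_compact_action]
      by (simp add: steinitz_order_eq_adapted_order assms)
    then show ?thesis
      by (rule steinitz_type_eqI)
  qed
qed

end
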